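(* The metric lines in $\mathrm{SE}(2)$ are precisely the geodesics of type line and of type heteroclinic; that is, a curve $\gamma:\mathbb{R}\to\mathrm{SE}(2)$ is a metric line if and only if it is an arc-length parameterized sub-Riemannian geodesic of type line or of type heteroclinic.
   Context: $\mathrm{SE}(2)=\mathrm{SO}(2)\ltimes\mathbb{R}^2$ is the special Euclidean group of the plane, with coordinates $(\theta,x,y)$, $\theta\in\mathbb{R}/2\pi\mathbb{Z}$, $(x,y)\in\mathbb{R}^2$. It carries the left-invariant sub-Riemannian structure whose distribution $\mathcal{D}$ has the orthonormal frame $X_\theta=\frac{\partial}{\partial\theta}$, $X_u=\cos\theta\frac{\partial}{\partial x}+\sin\theta\frac{\partial}{\partial y}$; the sub-Riemannian distance is the infimum of lengths of horizontal curves (curves tangent to $\mathcal{D}$) joining two points. With canonical coordinates $(p_\theta,p_x,p_y,\theta,x,y)$ on $T^*\mathrm{SE}(2)$, the sub-Riemannian geodesic flow is the Hamiltonian flow of $H_{sR}=\frac12\big(p_\theta^2+(p_x\cos\theta+p_y\sin\theta)^2\big)$. An arc-length parameterized geodesic is the projection $\gamma:\mathbb{R}\to\mathrm{SE}(2)$ of a solution of this flow with $H_{sR}=\frac12$. The functions $p_x,p_y$ are constants of motion; $\gamma$ has momentum $\mu$ if $(p_x,p_y)=\mu=(R\cos\delta,R\sin\delta)$ with $R\ge 0$. The reduced dynamics of $\gamma$ is the pair $(p_\theta(t),\theta(t))\in T^*\mathrm{SO}(2)$, which satisfies $p_\theta^2+R^2\cos^2(\theta-\delta)=1$, $\dot\theta=p_\theta$,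 $\dot p_\theta=R^2\cos(\theta-\delta)\sin(\theta-\delta)$. Types of geodesics: $\gamma$ is of type line if $\dot\theta\equiv0$ (equivalently $R=1$ and $\theta\equiv\delta$ or $\theta\equiv\delta+\pi$); $\gamma$ is of type heteroclinic if its reduced dynamics is heteroclinic, i.e. $R=1$ and $\dot\theta\ne0$. Metric line: a curve $\gamma:\mathbb{R}\to M$ in a sub-Riemannian manifold $M$ with distance $\mathrm{dist}_M$ is a metric line if it is a globally minimizing geodesic, i.e. $|a-b|=\mathrm{dist}_M(\gamma(a),\gamma(b))$ for all compact intervals $[a,b]\subset\mathbb{R}$. *)

theory Defs
  imports "HOL-Analysis.Analysis"
begin

text \<open>
  A point of SE(2) with coordinates (theta, x, y), theta taken modulo 2 pi, is represented by
  the triple (cis theta, x, y): the factor SO(2) = R / 2 pi Z is the unit circle in the complex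
  plane.
\<close>

type_synonym se2 = "complex \<times> real \<times> real"

definition se2_coords :: "real \<Rightarrow> real \<Rightarrow> real \<Rightarrow> se2" where
  "se2_coords \<theta> x y = (cis \<theta>, x, y)"

definition SE2 :: "se2 set" where
  "SE2 = {se2_coords \<theta> x y | \<theta> x y. True}"

text \<open>
  The orthonormal frame. In the ambient space the coordinate field d/dtheta is the velocity
  of theta \<mapsto> (cis theta, x, y), and cos theta, sin theta are the real and imaginary parts
  of cis theta.
\<close>

definition X_theta :: "se2 \<Rightarrow> se2" where
  "X_theta = (\<lambda>(z, x, y). (\<i> * z, 0, 0))"

definition X_u :: "se2 \<Rightarrow> se2" where
  "X_u = (\<lambda>(z, x, y). (0, Re z, Im z))"

text \<open>
  Horizontal curves are piecewise continuously differentiable and tangent to the distribution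
  away from finitely many parameters; \<open>v\<close> and \<open>w\<close> are the components of the velocity in the
  orthonormal frame.
\<close>

definition horizontal_on ::
    "real \<Rightarrow> real \<Rightarrow> (real \<Rightarrow> se2) \<Rightarrow> (real \<Rightarrow> real) \<Rightarrow> (real \<Rightarrow> real) \<Rightarrow> bool" where
  "horizontal_on a b c v w \<longleftrightarrow>
     c ` {a..b} \<subseteq> SE2 \<and>
     c piecewise_C1_differentiable_on {a..b} \<and>
     (\<exists>S. finite S \<and>
       (\<forall>t\<in>{a..b} - S.
         (c has_vector_derivative (v t *\<^sub>R X_theta (c t) + w t *\<^sub>R X_u (c t))) (at t)))"

text \<open>
  The library's piecewise C1 curves may have unbounded velocity near the exceptional parameters,
  hence infinite length; \<open>has_integral\<close> (rather than the total operator \<open>integral\<close>, which is 0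
  on non-integrable functions) makes such curves contribute no length.
\<close>

definition horizontal_lengths :: "se2 \<Rightarrow> se2 \<Rightarrow> real set" where
  "horizontal_lengths g h =
     {L. \<exists>a b c v w. a \<le> b \<and> horizontal_on a b c v w \<and> c a = g \<and> c b = h \<and>
           ((\<lambda>t. sqrt ((v t)\<^sup>2 + (w t)\<^sup>2)) has_integral L) {a..b}}"

definition sR_dist :: "se2 \<Rightarrow> se2 \<Rightarrow> real" where
  "sR_dist g h = Inf (horizontal_lengths g h)"

definition H_sR :: "real \<Rightarrow> real \<Rightarrow> real \<Rightarrow> real \<Rightarrow> real \<Rightarrow> real \<Rightarrow> real" where
  "H_sR p\<theta> px py \<theta> x y = 1/2 * (p\<theta>\<^sup>2 + (px * cos \<theta> + py * sin \<theta>)\<^sup>2)"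

text \<open>
  Hamilton's equations in canonical coordinates. A solution in the cotangent bundle of SE(2) is
  described by a continuous real-valued lift of its angle.
\<close>

definition hamiltonian_solution ::
    "(real \<Rightarrow> real) \<Rightarrow> (real \<Rightarrow> real) \<Rightarrow> (real \<Rightarrow> real) \<Rightarrow>
     (real \<Rightarrow> real) \<Rightarrow> (real \<Rightarrow> real) \<Rightarrow> (real \<Rightarrow> real) \<Rightarrow> bool" where
  "hamiltonian_solution p\<theta> px py \<theta> x y \<longleftrightarrow>
     (\<forall>t.
       (\<theta> has_real_derivative
          deriv (\<lambda>s. H_sR s (px t) (py t) (\<theta> t) (x t) (y t)) (p\<theta> t)) (at t) \<and>
       (x has_real_derivative
          deriv (\<lambda>s. H_sR (p\<theta> t) s (py t) (\<theta> t) (x t) (y t)) (px t)) (at t) \<and>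
       (y has_real_derivative
          deriv (\<lambda>s. H_sR (p\<theta> t) (px t) s (\<theta> t) (x t) (y t)) (py t)) (at t) \<and>
       (p\<theta> has_real_derivative
          - deriv (\<lambda>s. H_sR (p\<theta> t) (px t) (py t) s (x t) (y t)) (\<theta> t)) (at t) \<and>
       (px has_real_derivative
          - deriv (\<lambda>s. H_sR (p\<theta> t) (px t) (py t) (\<theta> t) s (y t)) (x t)) (at t) \<and>
       (py has_real_derivative
          - deriv (\<lambda>s. H_sR (p\<theta> t) (px t) (py t) (\<theta> t) (x t) s) (y t)) (at t))"

definition arc_length_lift ::
    "(real \<Rightarrow> se2) \<Rightarrow> (real \<Rightarrow> real) \<Rightarrow> (real \<Rightarrow> real) \<Rightarrow> (real \<Rightarrow> real) \<Rightarrow>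
     (real \<Rightarrow> real) \<Rightarrow> (real \<Rightarrow> real) \<Rightarrow> (real \<Rightarrow> real) \<Rightarrow> bool" where
  "arc_length_lift \<gamma> p\<theta> px py \<theta> x y \<longleftrightarrow>
     hamiltonian_solution p\<theta> px py \<theta> x y \<and>
     (\<forall>t. H_sR (p\<theta> t) (px t) (py t) (\<theta> t) (x t) (y t) = 1/2) \<and>
     (\<forall>t. \<gamma> t = se2_coords (\<theta> t) (x t) (y t))"

definition has_momentum :: "(real \<Rightarrow> real) \<Rightarrow> (real \<Rightarrow> real) \<Rightarrow> real \<Rightarrow> real \<Rightarrow> bool" where
  "has_momentum px py R \<delta> \<longleftrightarrow> R \<ge> 0 \<and> (\<forall>t. (px t, py t) = (R * cos \<delta>, R * sin \<delta>))"

definition geodesic_type_line :: "(real \<Rightarrow> se2) \<Rightarrow> bool" where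
  "geodesic_type_line \<gamma> \<longleftrightarrow>
     (\<exists>p\<theta> px py \<theta> x y. arc_length_lift \<gamma> p\<theta> px py \<theta> x y \<and> (\<forall>t. deriv \<theta> t = 0))"

text \<open>
  For R = 1 the angular velocity either vanishes identically or vanishes nowhere, so the
  condition below does not depend on the choice of quantifier.
\<close>

definition geodesic_type_heteroclinic :: "(real \<Rightarrow> se2) \<Rightarrow> bool" where
  "geodesic_type_heteroclinic \<gamma> \<longleftrightarrow>
     (\<exists>p\<theta> px py \<theta> x y R \<delta>. arc_length_lift \<gamma> p\<theta> px py \<theta> x y \<and>
        has_momentum px py R \<delta> \<and> R = 1 \<and> (\<exists>t. deriv \<theta> t \<noteq> 0))"

definition metric_line :: "(real \<Rightarrow> se2) \<Rightarrow> bool" where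
  "metric_line \<gamma> \<longleftrightarrow> (\<forall>a b. a \<le> b \<longrightarrow> \<bar>a - b\<bar> = sR_dist (\<gamma> a) (\<gamma> b))"

end

(*
  For a unit vector u and k = 1 or -1, the linear functional S(z, p) = u.p + k u.z on the ambient
  space of SE(2), z being the unit vector (cos theta, sin theta) and p the position, has horizontal
  gradient of length 1: its components are the scalar products of u with z and, up to sign, with
  the unit vector orthogonal to z. Hence S is a calibration: it increases along a horizontal curve by at most its length, and the geodesics of
  type line and heteroclinic are exactly the integral curves of its horizontal gradient.

  Conversely, along a metric line the position moves by t - s up to the bounded cost of two
  rotations. So the direction of motion converges to some u, and arbitrarily late and
  arbitrarily early there are times with z almost equal to u or -u. Far apart points whose angles
  are nearly parallel to their displacement are joined by rotations of small angle, a straight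
  piece and, if the two signs differ, a heteroclinic piece, so that some S increases
  between them by their distance up to a small error. In the limit some S increases by exactly
  t - s along the whole line. Perturbing S by a small multiple of an arbitrary functional
  then shows that the line is differentiable with velocity the horizontal gradient of S.
*)
theory Submission
  imports Defs
begin

section \<open>Linear functionals along horizontal curves\<close>

definition pt :: "complex \<Rightarrow> complex \<Rightarrow> se2" where
  "pt z p = (z, Re p, Im p)"

text \<open>The position is packed into one complex number, so that angle and position are both
  planar vectors and rotation is multiplication.\<close>

definition pos :: "se2 \<Rightarrow> complex" where
  "pos g = Complex (fst (snd g)) (snd (snd g))"

lemma fst_pt [simp]: "fst (pt z p) = z" and pos_pt [simp]: "pos (pt z p) = p"
  by (simp_all add: pt_def pos_def)

lemma pt_fst_pos [simp]: "pt (fst g) (pos g) = g"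
  by (simp add: pt_def pos_def)

lemma SE2_iff: "g \<in> SE2 \<longleftrightarrow> norm (fst g) = 1"
proof
  assume "norm (fst g) = 1"
  then have "cis (Arg (fst g)) = fst g"
    using cis_Arg[of "fst g"] by (cases "fst g = 0") (auto simp: sgn_div_norm)
  then have "g = se2_coords (Arg (fst g)) (fst (snd g)) (snd (snd g))"
    by (simp add: se2_coords_def)
  then show "g \<in> SE2"
    unfolding SE2_def by blast
qed (auto simp: SE2_def se2_coords_def)

lemma inner_pt: "inner (pt a b) (pt z p) = inner a z + inner b p"
  by (simp add: pt_def inner_complex_def)

lemma inner_pt_left: "inner (pt a b) g = inner a (fst g) + inner b (pos g)"
  using inner_pt[of a b "fst g" "pos g"] by simp

lemma X_theta_pt: "X_theta (pt z p) = pt (\<i> * z) 0"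
  and X_u_pt: "X_u (pt z p) = pt 0 z"
  by (simp_all add: X_theta_def X_u_def pt_def)

lemma X_theta_eq: "X_theta g = pt (\<i> * fst g) 0"
  and X_u_eq: "X_u g = pt 0 (fst g)"
  by (simp_all add: X_theta_def X_u_def pt_def split_beta)

lemma pt_add: "pt a b + pt c d = pt (a + c) (b + d)"
  and pt_diff: "pt a b - pt c d = pt (a - c) (b - d)"
  and pt_scaleR: "r *\<^sub>R pt a b = pt (r *\<^sub>R a) (r *\<^sub>R b)"
  by (simp_all add: pt_def)

lemma norm_pt: "(norm (pt a b))\<^sup>2 = (norm a)\<^sup>2 + (norm b)\<^sup>2"
  by (simp add: power2_norm_eq_inner inner_pt)

lemma fst_norm_le: "norm (fst g) \<le> norm (g :: se2)"
  by (metis norm_fst_le prod.collapse)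

lemma norm_X_diff:
  "norm (X_theta g - X_theta h) = norm (fst g - fst h)"
  "norm (X_u g - X_u h) = norm (fst g - fst h)"
proof -
  have *: "norm (pt (\<i> * a) 0) = norm a" "norm (pt 0 a) = norm a" for a
    using norm_pt[of "\<i> * a" 0] norm_pt[of 0 a] by (simp_all add: norm_mult)
  show "norm (X_theta g - X_theta h) = norm (fst g - fst h)"
    using *(1)[of "fst g - fst h"] by (simp add: X_theta_eq pt_diff right_diff_distrib)
  show "norm (X_u g - X_u h) = norm (fst g - fst h)"
    using *(2)[of "fst g - fst h"] by (simp add: X_u_eq pt_diff)
qed

lemma norm_X:
  assumes "g \<in> SE2"
  shows "norm (X_theta g) = 1" "norm (X_u g) = 1"
proof -
  \<comment> \<open>The formulas of the frame are linear in the ambient point, so lengths at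
    \<open>g\<close> are differences from the values at the ambient origin.\<close>
  have "X_theta 0 = 0" "X_u 0 = 0"
    by (simp_all add: X_theta_def X_u_def zero_prod_def)
  then show "norm (X_theta g) = 1" "norm (X_u g) = 1"
    using assms norm_X_diff[of g 0] by (simp_all add: SE2_iff)
qed

text \<open>The scalar product of the horizontal gradients at \<open>g\<close> of the linear
  functionals \<open>inner q\<close> and \<open>inner r\<close>, since the frame is
  orthonormal.\<close>

definition grad_inner :: "se2 \<Rightarrow> se2 \<Rightarrow> se2 \<Rightarrow> real" where
  "grad_inner q r g = inner q (X_theta g) * inner r (X_theta g) + inner q (X_u g) * inner r (X_u g)"

text \<open>Pythagoras in the orthonormal basis \<open>z\<close>, \<open>\<i> * z\<close> of the
  plane.\<close>

lemma inner_i_square: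
  assumes "norm z = 1"
  shows "(inner u (\<i> * z))\<^sup>2 + (inner u z)\<^sup>2 = (norm u)\<^sup>2"
proof -
  have "(inner u (\<i> * z))\<^sup>2 + (inner u z)\<^sup>2 = (norm u)\<^sup>2 * (norm z)\<^sup>2"
    unfolding cmod_power2 by (simp add: inner_complex_def power2_eq_square algebra_simps)
  then show ?thesis
    using assms by simp
qed

text \<open>The angular frame vector sees only the component of \<open>fst q\<close> along
  \<open>\<i> * fst g\<close>, the forward one only that of \<open>pos q\<close> along
  \<open>fst g\<close>.\<close>

lemma grad_inner_self_le:
  assumes "g \<in> SE2"
  shows "grad_inner q q g \<le> (norm q)\<^sup>2"
proof -
  have g: "norm (fst g) = 1"
    using assms by (simp add: SE2_iff)
  have "inner (pt (fst q) (pos q)) (X_theta g) = inner (fst q) (\<i> * fst g)"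
    "inner (pt (fst q) (pos q)) (X_u g) = inner (pos q) (fst g)"
    unfolding inner_pt_left by (simp_all add: X_theta_eq X_u_eq)
  then have "grad_inner q q g = (inner (fst q) (\<i> * fst g))\<^sup>2 + (inner (pos q) (fst g))\<^sup>2"
    by (simp add: grad_inner_def power2_eq_square)
  also have "\<dots> \<le> (norm (fst q))\<^sup>2 + (norm (pos q))\<^sup>2"
    using inner_i_square[OF g, of "fst q"] inner_i_square[OF g, of "pos q"]
      zero_le_power2[of "inner (fst q) (fst g)"] zero_le_power2[of "inner (pos q) (\<i> * fst g)"]
    by linarith
  also have "\<dots> = (norm q)\<^sup>2"
    using norm_pt[of "fst q" "pos q"] by simp
  finally show ?thesis .
qed

text \<open>The vector representing the calibration functional. The value \<open>k = 0\<close> is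
  used as well and leaves the coordinate of the position along \<open>u\<close>.\<close>

definition calib :: "real \<Rightarrow> complex \<Rightarrow> se2" where
  "calib k u = pt (k *\<^sub>R u) u"

lemma inner_calib: "inner (calib k u) g = k * inner u (fst g) + inner u (pos g)"
  by (simp add: calib_def inner_pt_left)

text \<open>The eikonal equation: the gradient components are \<open>k\<close> times the product of
  \<open>u\<close> with \<open>\<i> * fst g\<close>, and the product of \<open>u\<close> with
  \<open>fst g\<close>, so Pythagoras applies.\<close>

lemma grad_calib_self:
  assumes "k\<^sup>2 = 1" "norm u = 1" "g \<in> SE2"
  shows "grad_inner (calib k u) (calib k u) g = 1"
proof -
  have "grad_inner (calib k u) (calib k u) g
      = k\<^sup>2 * (inner u (\<i> * fst g))\<^sup>2 + (inner u (fst g))\<^sup>2"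
    by (simp add: grad_inner_def inner_calib X_theta_eq X_u_eq power2_eq_square algebra_simps)
  then show ?thesis
    using assms inner_i_square[of "fst g" u] by (simp add: SE2_iff)
qed

text \<open>On the group the frame consists of unit vectors that vary with the angle only, with
  Lipschitz constant 1, so each of the two products contributes 2 to the constant.\<close>

lemma grad_inner_lipschitz:
  assumes "g \<in> SE2" "h \<in> SE2"
  shows "\<bar>grad_inner q r g - grad_inner q r h\<bar> \<le> 4 * norm q * norm r * norm (g - h)"
proof -
  have *: "\<bar>inner q (X g) * inner r (X g) - inner q (X h) * inner r (X h)\<bar>
      \<le> 2 * norm q * norm r * norm (g - h)"
    if n: "norm (X g) = 1" "norm (X h) = 1" "norm (X g - X h) = norm (fst g - fst h)"
    for X :: "se2 \<Rightarrow> se2"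
  proof -
    have d: "norm (X g - X h) \<le> norm (g - h)"
      using n(3) fst_norm_le[of "g - h"] by simp
    have "inner q (X g) * inner r (X g) - inner q (X h) * inner r (X h)
        = inner q (X g) * inner r (X g - X h) + inner q (X g - X h) * inner r (X h)"
      by (simp add: inner_diff_right algebra_simps)
    moreover have "\<bar>inner q (X g) * inner r (X g - X h)\<bar> \<le> norm q * (norm r * norm (g - h))"
      unfolding abs_mult
    proof (rule mult_mono)
      show "\<bar>inner q (X g)\<bar> \<le> norm q"
        using Cauchy_Schwarz_ineq2[of q "X g"] n by simp
      show "\<bar>inner r (X g - X h)\<bar> \<le> norm r * norm (g - h)"
        using Cauchy_Schwarz_ineq2[of r "X g - X h"] mult_left_mono[OF d, of "norm r"] by simp
    qed auto
    moreover have "\<bar>inner q (X g - X h) * inner r (X h)\<bar> \<le> norm q * norm (g - h) * norm r"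
      unfolding abs_mult
    proof (rule mult_mono)
      show "\<bar>inner r (X h)\<bar> \<le> norm r"
        using Cauchy_Schwarz_ineq2[of r "X h"] n by simp
      show "\<bar>inner q (X g - X h)\<bar> \<le> norm q * norm (g - h)"
        using Cauchy_Schwarz_ineq2[of q "X g - X h"] mult_left_mono[OF d, of "norm q"] by simp
    qed auto
    ultimately show ?thesis
      by (simp add: algebra_simps)
  qed
  show ?thesis
    using *[of X_theta, OF norm_X(1)[OF assms(1)] norm_X(1)[OF assms(2)] norm_X_diff(1)]
      *[of X_u, OF norm_X(2)[OF assms(1)] norm_X(2)[OF assms(2)] norm_X_diff(2)]
    unfolding grad_inner_def by linarith
qed

section \<open>Length estimates from linear functionals\<close>

lemma horizontal_on_SE2:
  assumes "horizontal_on a b c v w" "t \<in> {a..b}"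
  shows "c t \<in> SE2"
  using assms unfolding horizontal_on_def by blast

text \<open>The derivative of \<open>inner q\<close> along the curve is the product of the velocity
  components with the gradient components; Cauchy-Schwarz bounds it by \<open>K\<close> times the
  speed.\<close>

lemma horizontal_inner_le:
  assumes hor: "horizontal_on a b c v w"
    and L: "((\<lambda>t. sqrt ((v t)\<^sup>2 + (w t)\<^sup>2)) has_integral L) {a..b}"
    and ab: "a \<le> b" and K: "0 \<le> K"
    and grad: "\<And>t. t \<in> {a..b} \<Longrightarrow> grad_inner q q (c t) \<le> K\<^sup>2"
  shows "inner q (c b - c a) \<le> K * L"
proof -
  obtain S where S: "finite S"
    and der: "\<And>t. t \<in> {a..b} - S \<Longrightarrow>
      (c has_vector_derivative (v t *\<^sub>R X_theta (c t) + w t *\<^sub>R X_u (c t))) (at t)"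
    using hor unfolding horizontal_on_def by blast
  have cont: "continuous_on {a..b} c"
    using hor unfolding horizontal_on_def piecewise_C1_differentiable_on_def by blast
  let ?f = "\<lambda>t. inner q (v t *\<^sub>R X_theta (c t) + w t *\<^sub>R X_u (c t))"
  have "((?f) has_integral (inner q (c b) - inner q (c a))) {a..b}"
  proof (rule fundamental_theorem_of_calculus_interior_strong[OF S ab])
    fix t assume "t \<in> {a<..<b} - S"
    then show "((\<lambda>t. inner q (c t)) has_vector_derivative ?f t) (at t)"
      by (intro bounded_linear.has_vector_derivative[OF bounded_linear_inner_right] der) auto
  qed (intro continuous_intros cont)
  moreover have "?f t \<le> K * sqrt ((v t)\<^sup>2 + (w t)\<^sup>2)" if t: "t \<in> {a..b}" for t
  proof -
    define A B where "A = inner q (X_theta (c t))" and "B = inner q (X_u (c t))"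
    have AB: "sqrt (A\<^sup>2 + B\<^sup>2) \<le> K"
      using grad[OF t] K by (intro real_le_lsqrt) (auto simp: grad_inner_def A_def B_def power2_eq_square)
    have "?f t = v t * A + w t * B"
      by (simp add: A_def B_def inner_add_right)
    also have "\<dots> = inner (v t, w t) (A, B)"
      by simp
    also have "\<dots> \<le> norm (v t, w t) * norm (A, B)"
      by (rule norm_cauchy_schwarz)
    also have "\<dots> = sqrt (A\<^sup>2 + B\<^sup>2) * sqrt ((v t)\<^sup>2 + (w t)\<^sup>2)"
      by (simp add: norm_Pair)
    also have "\<dots> \<le> K * sqrt ((v t)\<^sup>2 + (w t)\<^sup>2)"
      by (rule mult_right_mono[OF AB]) auto
    finally show ?thesis .
  qed
  ultimately have "inner q (c b) - inner q (c a) \<le> K * L"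
    by (intro has_integral_le[OF _ has_integral_mult_right[OF L]]) auto
  then show ?thesis
    by (simp add: inner_diff_right)
qed

lemma horizontal_on_initial:
  assumes "horizontal_on a b c v w" "t \<le> b"
  shows "horizontal_on a t c v w"
proof -
  have sub: "{a..t} \<subseteq> {a..b}"
    using assms by auto
  show ?thesis
    using assms(1) sub piecewise_C1_differentiable_on_subset[OF _ sub]
    unfolding horizontal_on_def by (meson Diff_mono image_mono order_refl order_trans subsetD)
qed

lemma horizontal_norm_le:
  assumes hor: "horizontal_on a b c v w"
    and L: "((\<lambda>t. sqrt ((v t)\<^sup>2 + (w t)\<^sup>2)) has_integral L) {a..b}"
    and t: "t \<in> {a..b}"
  shows "norm (c t - c a) \<le> L"
proof -
  let ?f = "\<lambda>t. sqrt ((v t)\<^sup>2 + (w t)\<^sup>2)"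
  have int: "?f integrable_on {a..b}"
    using L by blast
  have "?f integrable_on {a..t}"
    using integrable_on_subinterval[OF int, of a t] t by auto
  then obtain L' where L': "(?f has_integral L') {a..t}"
    by blast
  have "L' \<le> L"
    by (rule has_integral_subset_le[OF _ L' L]) (use t in auto)
  have hor': "horizontal_on a t c v w"
    using horizontal_on_initial[OF hor] t by auto
  \<comment> \<open>Testing with the displacement itself turns the bound on functionals into a bound
    on its norm.\<close>
  define q where "q = c t - c a"
  have "inner q (c t - c a) \<le> norm q * L'"
    by (rule horizontal_inner_le[OF hor' L'])
      (use t in \<open>simp_all add: grad_inner_self_le horizontal_on_SE2[OF hor']\<close>)
  then have "norm q * norm q \<le> norm q * L'"
    by (simp add: q_def power2_norm_eq_inner[symmetric] power2_eq_square)
  moreover have "0 \<le> L'"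
    by (rule has_integral_nonneg[OF L']) auto
  ultimately have "norm q \<le> L'"
    by (cases "norm q = 0") auto
  with \<open>L' \<le> L\<close> show ?thesis
    by (simp add: q_def)
qed

lemma horizontal_lengths_nonneg: "L \<in> horizontal_lengths g h \<Longrightarrow> 0 \<le> L"
  unfolding horizontal_lengths_def by (auto intro: has_integral_nonneg)

lemma bdd_below_horizontal_lengths: "bdd_below (horizontal_lengths g h)"
  by (meson bdd_belowI horizontal_lengths_nonneg)

lemma sR_dist_le: "L \<in> horizontal_lengths g h \<Longrightarrow> sR_dist g h \<le> L"
  unfolding sR_dist_def by (rule cInf_lower[OF _ bdd_below_horizontal_lengths])

text \<open>A curve of length \<open>L\<close> stays in the ambient ball of radius \<open>L\<close>
  about \<open>g\<close>, so the gradient has to be controlled there only; for short curves it is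
  nearly constant.\<close>

lemma horizontal_lengths_inner_le:
  assumes L: "L \<in> horizontal_lengths g h" and K: "0 \<le> K"
    and grad: "\<And>p. p \<in> SE2 \<Longrightarrow> norm (p - g) \<le> L \<Longrightarrow> grad_inner q q p \<le> K\<^sup>2"
  shows "inner q (h - g) \<le> K * L"
proof -
  obtain a b c v w where ab: "a \<le> b" and hor: "horizontal_on a b c v w" and c: "c a = g" "c b = h"
    and int: "((\<lambda>t. sqrt ((v t)\<^sup>2 + (w t)\<^sup>2)) has_integral L) {a..b}"
    using L unfolding horizontal_lengths_def by blast
  have "grad_inner q q (c t) \<le> K\<^sup>2" if "t \<in> {a..b}" for t
    using grad horizontal_on_SE2[OF hor that] horizontal_norm_le[OF hor int that] c by simp
  from horizontal_inner_le[OF hor int ab K this] show ?thesis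
    by (simp add: c)
qed

section \<open>Curves of constant speed: rotations and straight pieces\<close>

lemma const_speed_length:
  assumes z: "\<And>t. (z has_vector_derivative (v t *\<^sub>R (\<i> * z t))) (at t)"
    and p: "\<And>t. (p has_vector_derivative (w t *\<^sub>R z t)) (at t)"
    and nz: "\<And>t. norm (z t) = 1"
    and cv: "continuous_on UNIV v" and cw: "continuous_on UNIV w"
    and sp: "\<And>t. sqrt ((v t)\<^sup>2 + (w t)\<^sup>2) = l" and ab: "a \<le> b"
  shows "l * (b - a) \<in> horizontal_lengths (pt (z a) (p a)) (pt (z b) (p b))"
proof -
  define c where "c t = pt (z t) (p t)" for t
  have bl: "bounded_linear (\<lambda>(z, p). pt z p)"
    unfolding pt_def split_beta
    by (intro bounded_linear_Pair bounded_linear_fst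
        bounded_linear_compose[OF bounded_linear_Re bounded_linear_snd]
        bounded_linear_compose[OF bounded_linear_Im bounded_linear_snd])
  have der: "(c has_vector_derivative (v t *\<^sub>R X_theta (c t) + w t *\<^sub>R X_u (c t))) (at t)" for t
    using bounded_linear.has_vector_derivative[OF bl has_vector_derivative_Pair[OF z p], of t]
    by (simp add: c_def[abs_def] X_theta_pt X_u_pt pt_scaleR pt_add)
  have cz: "continuous_on UNIV z"
    using z by (meson continuous_at_imp_continuous_on has_vector_derivative_continuous)
  have cD: "continuous_on UNIV (\<lambda>t. v t *\<^sub>R X_theta (c t) + w t *\<^sub>R X_u (c t))"
    unfolding c_def X_theta_pt X_u_pt unfolding pt_def
    by (intro continuous_intros cv cw cz)
  have "c C1_differentiable_on {a..b}"
    unfolding C1_differentiable_on_def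
    by (intro exI conjI ballI, rule der, rule continuous_on_subset[OF cD subset_UNIV])
  then have "horizontal_on a b c v w"
    unfolding horizontal_on_def using der nz
    by (auto intro!: C1_differentiable_imp_piecewise exI[of _ "{}"] simp: SE2_iff c_def)
  moreover have "((\<lambda>t. sqrt ((v t)\<^sup>2 + (w t)\<^sup>2)) has_integral l * (b - a)) {a..b}"
    unfolding sp using has_integral_const_real[of l a b] ab by (simp add: mult.commute)
  ultimately show ?thesis
    unfolding horizontal_lengths_def using ab
    by (intro CollectI exI[of _ a] exI[of _ b] exI[of _ c] exI[of _ v] exI[of _ w])
      (simp add: c_def)
qed

lemma length_rotation:
  assumes "norm z = 1"
  shows "\<bar>\<theta>\<bar> \<in> horizontal_lengths (pt z p) (pt (z * cis \<theta>) p)"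
proof -
  have "((\<lambda>t. z * cis (\<theta> * t)) has_vector_derivative (\<theta> *\<^sub>R (\<i> * (z * cis (\<theta> * t))))) (at t)" for t
  proof -
    have "((\<lambda>s. z * exp (\<i> * (of_real \<theta> * s))) has_field_derivative
        of_real \<theta> * (\<i> * (z * exp (\<i> * (of_real \<theta> * of_real t))))) (at (of_real t))"
      by (auto intro!: derivative_eq_intros)
    from has_vector_derivative_real_field[OF this] show ?thesis
      by (simp add: cis_conv_exp scaleR_conv_of_real)
  qed
  from const_speed_length[where w = "\<lambda>_. 0" and p = "\<lambda>_. p" and l = "\<bar>\<theta>\<bar>" and a = 0 and b = 1, OF this]
  show ?thesis
    using assms by (simp add: norm_mult)
qed

lemma length_straight:
  assumes "norm z = 1"
  shows "\<bar>s\<bar> \<in> horizontal_lengths (pt z p) (pt z (p + s *\<^sub>R z))"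
proof -
  have "((\<lambda>t. p + t *\<^sub>R (s *\<^sub>R z)) has_vector_derivative (s *\<^sub>R z)) (at t)" for t
    by (auto intro!: derivative_eq_intros)
  from const_speed_length[where v = "\<lambda>_. 0" and w = "\<lambda>_. s" and z = "\<lambda>_. z" and l = "\<bar>s\<bar>"
      and a = 0 and b = 1, OF _ this]
  show ?thesis
    using assms by simp
qed

section \<open>Concatenation and explicit curves\<close>

lemma horizontal_on_shift:
  assumes hor: "horizontal_on a b c v w"
  shows "horizontal_on (a - k) (b - k) (\<lambda>t. c (t + k)) (\<lambda>t. v (t + k)) (\<lambda>t. w (t + k))"
proof -
  obtain S where S: "finite S"
    and der: "\<And>t. t \<in> {a..b} - S \<Longrightarrow>
      (c has_vector_derivative (v t *\<^sub>R X_theta (c t) + w t *\<^sub>R X_u (c t))) (at t)"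
    using hor unfolding horizontal_on_def by blast
  have im: "(\<lambda>x. 1 * x + k) ` {a - k..b - k} = {a..b}"
    by (simp add: add.commute[of _ k])
  have "(c \<circ> (\<lambda>x. 1 *\<^sub>R x + k)) piecewise_C1_differentiable_on {a - k..b - k}"
    using hor unfolding horizontal_on_def
    by (intro piecewise_C1_differentiable_affine) (simp add: im[simplified])
  moreover have "((\<lambda>t. c (t + k)) has_vector_derivative
      (v (t + k) *\<^sub>R X_theta (c (t + k)) + w (t + k) *\<^sub>R X_u (c (t + k)))) (at t)"
    if "t \<in> {a - k..b - k} - (\<lambda>s. s - k) ` S" for t
  proof -
    have "t + k \<in> {a..b} - S"
      using that by force
    moreover have "((\<lambda>t. t + k) has_vector_derivative 1) (at t)"
      by (auto intro!: derivative_eq_intros)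
    ultimately show ?thesis
      using vector_diff_chain_at[of "\<lambda>t. t + k" 1 t, OF _ der] by (simp add: o_def)
  qed
  moreover have "(\<lambda>t. c (t + k)) ` {a - k..b - k} \<subseteq> SE2"
    using horizontal_on_SE2[OF hor] by auto
  ultimately show ?thesis
    unfolding horizontal_on_def using S
    by (auto simp: o_def intro!: exI[of _ "(\<lambda>s. s - k) ` S"])
qed

lemma horizontal_lengths_add:
  assumes "L1 \<in> horizontal_lengths g h" "L2 \<in> horizontal_lengths h k"
  shows "L1 + L2 \<in> horizontal_lengths g k"
proof -
  obtain a b c1 v1 w1 where ab: "a \<le> b" and hor1: "horizontal_on a b c1 v1 w1"
    and c1: "c1 a = g" "c1 b = h"
    and L1: "((\<lambda>t. sqrt ((v1 t)\<^sup>2 + (w1 t)\<^sup>2)) has_integral L1) {a..b}"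
    using assms(1) unfolding horizontal_lengths_def by blast
  obtain a' b' c' v' w' where ab': "a' \<le> b'" and hor': "horizontal_on a' b' c' v' w'"
    and c': "c' a' = h" "c' b' = k"
    and L': "((\<lambda>t. sqrt ((v' t)\<^sup>2 + (w' t)\<^sup>2)) has_integral L2) {a'..b'}"
    using assms(2) unfolding horizontal_lengths_def by blast
  define s where "s = a' - b"
  \<comment> \<open>The second curve is reparameterized to start at the final time \<open>b\<close>
    of the first; \<open>b\<close> itself becomes an exceptional time of the concatenation.\<close>
  define d where "d = b' - s"
  define c2 v2 w2 where "c2 t = c' (t + s)" and "v2 t = v' (t + s)" and "w2 t = w' (t + s)" for t
  have bd: "b \<le> d" and a's: "a' - s = b"
    using ab' by (simp_all add: d_def s_def)
  have hor2: "horizontal_on b d c2 v2 w2"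
    using horizontal_on_shift[OF hor', of s] by (simp add: a's d_def c2_def[abs_def] v2_def[abs_def] w2_def[abs_def])
  have L2: "((\<lambda>t. sqrt ((v2 t)\<^sup>2 + (w2 t)\<^sup>2)) has_integral L2) {b..d}"
    using has_integral_shift_real_ivl[OF L', of s] by (simp add: a's d_def v2_def w2_def)
  have c2: "c2 b = h" "c2 d = k"
    using c' by (simp_all add: c2_def d_def s_def)
  define c v w where "c t = (if t \<le> b then c1 t else c2 t)"
    and "v t = (if t \<le> b then v1 t else v2 t)" and "w t = (if t \<le> b then w1 t else w2 t)" for t
  obtain S1 where S1: "finite S1"
    and der1: "\<And>t. t \<in> {a..b} - S1 \<Longrightarrow>
      (c1 has_vector_derivative (v1 t *\<^sub>R X_theta (c1 t) + w1 t *\<^sub>R X_u (c1 t))) (at t)"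
    using hor1 unfolding horizontal_on_def by blast
  obtain S2 where S2: "finite S2"
    and der2: "\<And>t. t \<in> {b..d} - S2 \<Longrightarrow>
      (c2 has_vector_derivative (v2 t *\<^sub>R X_theta (c2 t) + w2 t *\<^sub>R X_u (c2 t))) (at t)"
    using hor2 unfolding horizontal_on_def by blast
  have "(c has_vector_derivative (v t *\<^sub>R X_theta (c t) + w t *\<^sub>R X_u (c t))) (at t)"
    if t: "t \<in> {a..d} - (S1 \<union> S2 \<union> {b})" for t
  proof (cases "t < b")
    case True
    have "(c has_vector_derivative (v1 t *\<^sub>R X_theta (c1 t) + w1 t *\<^sub>R X_u (c1 t))) (at t)"
      by (rule has_vector_derivative_transform_within_open[OF der1, of _ "{..<b}"])
        (use t True in \<open>auto simp: c_def\<close>)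
    then show ?thesis
      using True by (simp add: c_def v_def w_def)
  next
    case False
    have "(c has_vector_derivative (v2 t *\<^sub>R X_theta (c2 t) + w2 t *\<^sub>R X_u (c2 t))) (at t)"
      by (rule has_vector_derivative_transform_within_open[OF der2, of _ "{b<..}"])
        (use t False in \<open>auto simp: c_def\<close>)
    then show ?thesis
      using False t by (simp add: c_def v_def w_def)
  qed
  moreover have "c piecewise_C1_differentiable_on {a..d}"
    unfolding c_def[abs_def] using hor1 hor2 ab bd c1 c2
    by (intro piecewise_C1_differentiable_cases) (auto simp: horizontal_on_def)
  moreover have "c ` {a..d} \<subseteq> SE2"
    using horizontal_on_SE2[OF hor1] horizontal_on_SE2[OF hor2] by (auto simp: c_def)
  ultimately have "horizontal_on a d c v w"
    unfolding horizontal_on_def using S1 S2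
    by (intro conjI exI[of _ "S1 \<union> S2 \<union> {b}"]) auto
  moreover have "((\<lambda>t. sqrt ((v t)\<^sup>2 + (w t)\<^sup>2)) has_integral (L1 + L2)) {a..d}"
  proof (rule has_integral_combine[OF ab bd])
    show "((\<lambda>t. sqrt ((v t)\<^sup>2 + (w t)\<^sup>2)) has_integral L1) {a..b}"
      by (rule has_integral_spike_finite[OF _ _ L1, of "{}"]) (auto simp: v_def w_def)
    show "((\<lambda>t. sqrt ((v t)\<^sup>2 + (w t)\<^sup>2)) has_integral L2) {b..d}"
      by (rule has_integral_spike_finite[OF _ _ L2, of "{b}"]) (auto simp: v_def w_def)
  qed
  moreover have "a \<le> d" "c a = g" "c d = k"
    using ab bd c1 c2 by (auto simp: c_def)
  ultimately show ?thesis
    unfolding horizontal_lengths_def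
    by (intro CollectI exI[of _ a] exI[of _ d] exI[of _ c] exI[of _ v] exI[of _ w]) simp
qed

text \<open>The angle is the principal argument of \<open>z' / z\<close>, hence at most pi; for
  close vectors it is the imaginary part of a logarithm near 1, which is at most twice the
  distance.\<close>

lemma ex_length_rotation:
  assumes z: "norm z = 1" "norm z' = 1"
  obtains \<theta> where "\<bar>\<theta>\<bar> \<le> pi" "\<And>p. \<bar>\<theta>\<bar> \<in> horizontal_lengths (pt z p) (pt z' p)"
    "norm (z' - z) < 1/2 \<longrightarrow> \<bar>\<theta>\<bar> \<le> 2 * norm (z' - z)"
proof -
  have z0: "z \<noteq> 0" and nq: "norm (z' / z) = 1"
    using z by (auto simp: norm_divide)
  define \<theta> where "\<theta> = Arg (z' / z)"
  have q0: "z' / z \<noteq> 0"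
    using nq by force
  have "cis \<theta> = z' / z"
    using cis_Arg[OF q0] nq by (simp add: \<theta>_def sgn_div_norm)
  then have zc: "z' = z * cis \<theta>"
    using z0 by simp
  have "\<bar>\<theta>\<bar> \<le> 2 * norm (z' - z)" if lt: "norm (z' - z) < 1/2"
  proof -
    have e: "z' / z = 1 + (z' / z - 1)" "norm (z' / z - 1) = norm (z' - z)"
    proof -
      have "z' / z - 1 = (z' - z) / z"
        using z0 by (simp add: diff_divide_distrib)
      then show "norm (z' / z - 1) = norm (z' - z)"
        using z by (simp add: norm_divide)
    qed simp
    have "\<bar>\<theta>\<bar> = \<bar>Im (Ln (z' / z))\<bar>"
      using q0 by (simp add: \<theta>_def Arg_eq_Im_Ln)
    also have "\<dots> \<le> norm (Ln (1 + (z' / z - 1)))"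
      using abs_Im_le_cmod e(1) by metis
    also have "\<dots> \<le> 2 * norm (z' / z - 1)"
      by (rule norm_Ln_le) (use e lt in simp)
    finally show ?thesis
      using e by simp
  qed
  moreover have "\<bar>\<theta>\<bar> \<le> pi"
    using Arg_bounded[of "z' / z"] by (auto simp: \<theta>_def abs_le_iff)
  ultimately show ?thesis
    using that[of \<theta>] length_rotation[OF z(1), of \<theta>] zc by simp
qed

lemma heteroclinic_norm: "norm (Complex (- tanh t) (1 / cosh t)) = (1::real)"
proof -
  have "(tanh t)\<^sup>2 + (1 / cosh t)\<^sup>2 = ((sinh t)\<^sup>2 + 1) / (cosh t)\<^sup>2"
    by (simp add: tanh_def power_divide add_divide_distrib)
  also have "\<dots> = 1"
    using cosh_square_eq[of t] cosh_real_pos[of t] by (metis less_irrefl power_not_zero divide_self)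
  finally show ?thesis
    by (simp add: cmod_def)
qed

text \<open>
  The unit vector \<open>(- tanh t, 1 / cosh t)\<close> is the solution of \<open>\<theta>' = sin \<theta>\<close> running from 0 to pi; the sign
  \<open>s\<close> replaces \<open>\<theta>\<close> by \<open>\<theta> + pi\<close>, that is, traverses the same planar curve in reverse gear.
\<close>

lemma length_heteroclinic:
  fixes z :: complex and T :: real
  assumes z: "norm z = 1" and T: "0 \<le> T" and s: "s\<^sup>2 = 1"
  shows "2 * T \<in> horizontal_lengths
    (pt (s *\<^sub>R (z * Complex (tanh T) (1 / cosh T))) p)
    (pt (s *\<^sub>R (z * Complex (- tanh T) (1 / cosh T))) (p + (2 * T - 2 * tanh T) *\<^sub>R z))"
proof -
  define E where "E t = Complex (- tanh t) (1 / cosh t)" for t :: real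
  \<comment> \<open>\<open>(t - tanh t, 1 / cosh t)\<close> is the tractrix, turned by
    \<open>z\<close> and translated to start in \<open>p\<close> at time \<open>- T\<close>. Its
    velocity is \<open>- tanh t\<close> times the unit tangent \<open>E t\<close>.\<close>
  define P where "P t = p + z * (Complex (t - tanh t) (1 / cosh t) - Complex (- T + tanh T) (1 / cosh T))" for t
  have ch: "cosh t \<noteq> 0" for t :: real
    using cosh_real_pos[of t] by simp
  have ch2: "cosh t * cosh t = 1 + sinh t * sinh t" for t :: real
    using cosh_square_eq[of t] by (simp add: power2_eq_square)
  have dE: "(E has_vector_derivative ((1 / cosh t) *\<^sub>R (\<i> * E t))) (at t)" for t
  proof -
    have 1: "((\<lambda>t. - tanh t) has_real_derivative - (1 / (cosh t)\<^sup>2)) (at t)"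
      using ch[of t] ch2[of t] by (auto intro!: derivative_eq_intros simp: tanh_def field_simps power2_eq_square)
    have 2: "((\<lambda>t. 1 / cosh t) has_real_derivative - (sinh t / (cosh t)\<^sup>2)) (at t)"
      using ch[of t] by (auto intro!: derivative_eq_intros simp: field_simps power2_eq_square)
    have "(E has_vector_derivative Complex (- (1 / (cosh t)\<^sup>2)) (- (sinh t / (cosh t)\<^sup>2))) (at t)"
      unfolding E_def[abs_def] has_vector_derivative_complex_iff
      using 1 2 by (simp add: has_real_derivative_iff_has_vector_derivative)
    moreover have "Complex (- (1 / (cosh t)\<^sup>2)) (- (sinh t / (cosh t)\<^sup>2)) = (1 / cosh t) *\<^sub>R (\<i> * E t)"
      by (simp add: E_def complex_eq_iff tanh_def power2_eq_square)
    ultimately show ?thesis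
      by simp
  qed
  have ss: "s * s = 1"
    using s by (simp add: power2_eq_square)
  have dzE: "((\<lambda>t. s *\<^sub>R (z * E t)) has_vector_derivative ((1 / cosh t) *\<^sub>R (\<i> * (s *\<^sub>R (z * E t))))) (at t)" for t
    using has_vector_derivative_mult_right[OF dE, of "s *\<^sub>R z" t] by (simp add: mult.left_commute)
  have dP: "(P has_vector_derivative ((- s * tanh t) *\<^sub>R (s *\<^sub>R (z * E t)))) (at t)" for t
  proof -
    have 1: "((\<lambda>t. t - tanh t) has_real_derivative (tanh t)\<^sup>2) (at t)"
      using ch[of t] ch2[of t] by (auto intro!: derivative_eq_intros simp: tanh_def field_simps power2_eq_square)
    have 2: "((\<lambda>t. 1 / cosh t) has_real_derivative - (sinh t / (cosh t)\<^sup>2)) (at t)"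
      using ch[of t] by (auto intro!: derivative_eq_intros simp: field_simps power2_eq_square)
    have "((\<lambda>t. Complex (t - tanh t) (1 / cosh t)) has_vector_derivative
        Complex ((tanh t)\<^sup>2) (- (sinh t / (cosh t)\<^sup>2))) (at t)"
      unfolding has_vector_derivative_complex_iff
      using 1 2 by (simp add: has_real_derivative_iff_has_vector_derivative)
    moreover have "Complex ((tanh t)\<^sup>2) (- (sinh t / (cosh t)\<^sup>2)) = (- tanh t) *\<^sub>R E t"
      by (simp add: E_def complex_eq_iff tanh_def power2_eq_square)
    ultimately have "((\<lambda>t. Complex (t - tanh t) (1 / cosh t)) has_vector_derivative (- tanh t) *\<^sub>R E t) (at t)"
      by simp
    then have "((\<lambda>t. Complex (t - tanh t) (1 / cosh t) - Complex (- T + tanh T) (1 / cosh T))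
        has_vector_derivative (- tanh t) *\<^sub>R E t) (at t)"
      by (auto intro!: derivative_eq_intros)
    note d = has_vector_derivative_add[OF has_vector_derivative_const has_vector_derivative_mult_right[OF this, of z]]
    have "(- s * tanh t) *\<^sub>R (s *\<^sub>R (z * E t)) = (- tanh t) *\<^sub>R ((s * s) *\<^sub>R (z * E t))"
      by (simp add: algebra_simps)
    then have eq: "(- s * tanh t) *\<^sub>R (s *\<^sub>R (z * E t)) = 0 + z * ((- tanh t) *\<^sub>R E t)"
      unfolding ss by simp
    show ?thesis
      using d[of p] unfolding P_def[abs_def] eq .
  qed
  have "1 * (T - (- T)) \<in> horizontal_lengths 
      (pt (s *\<^sub>R (z * E (- T))) (P (- T))) (pt (s *\<^sub>R (z * E T)) (P T))"
  proof (rule const_speed_length[OF dzE dP])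
    show "norm (s *\<^sub>R (z * E t)) = 1" for t
      using z heteroclinic_norm[of t] s by (auto simp: norm_mult E_def power2_eq_1_iff)
    show "continuous_on UNIV (\<lambda>t. 1 / cosh t :: real)" "continuous_on UNIV (\<lambda>t. - s * tanh t :: real)"
      using ch by (auto intro!: continuous_intros)
    \<comment> \<open>Turning speed \<open>1 / cosh t\<close> and driving speed
      \<open>- s * tanh t\<close> combine to unit speed, so the length is the parameter span
      \<open>2 * T\<close>.\<close>
    show "sqrt ((1 / cosh t)\<^sup>2 + (- s * tanh t)\<^sup>2) = 1" for t :: real
      using heteroclinic_norm[of t] s by (simp add: cmod_def add.commute power_mult_distrib)
  qed (use T in auto)
  moreover have "P (- T) = p" "P T = p + (2 * T - 2 * tanh T) *\<^sub>R z" "E (- T) = Complex (tanh T) (1 / cosh T)"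
    by (simp_all add: P_def E_def complex_eq_iff algebra_simps)
  ultimately show ?thesis
    by (simp add: E_def)
qed

section \<open>Two-sided comparison of the distance with linear functionals\<close>

lemma
  assumes "g \<in> SE2" "h \<in> SE2"
  shows horizontal_lengths_nonempty: "horizontal_lengths g h \<noteq> {}"
    and sR_dist_pos_bounds: "sR_dist g h \<le> norm (pos h - pos g) + 2 * pi"
      "norm (pos h - pos g) \<le> sR_dist g h"
proof -
  obtain z p where g: "g = pt z p" "norm z = 1"
    using assms(1) pt_fst_pos[of g] by (metis SE2_iff)
  obtain z' p' where h: "h = pt z' p'" "norm z' = 1"
    using assms(2) pt_fst_pos[of h] by (metis SE2_iff)
  define r where "r = norm (p' - p)"
  \<comment> \<open>The direction of travel; for equal positions any unit vector serves.\<close>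
  obtain e where e: "norm e = 1" "p' = p + r *\<^sub>R e"
  proof (cases "p' = p")
    case True
    then show ?thesis
      using that[of 1] by (simp add: r_def)
  next
    case False
    then show ?thesis
      using that[of "sgn (p' - p)"] by (simp add: r_def norm_sgn sgn_div_norm)
  qed
  obtain \<theta> where \<theta>: "\<bar>\<theta>\<bar> \<le> pi" "\<And>p. \<bar>\<theta>\<bar> \<in> horizontal_lengths (pt z p) (pt e p)"
    using ex_length_rotation[OF g(2) e(1)] by metis
  obtain \<phi> where \<phi>: "\<bar>\<phi>\<bar> \<le> pi" "\<And>p. \<bar>\<phi>\<bar> \<in> horizontal_lengths (pt e p) (pt z' p)"
    using ex_length_rotation[OF e(1) h(2)] by metis
  \<comment> \<open>The competitor turns towards the target, drives straight and turns to the final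
    angle, each turn costing at most pi.\<close>
  have "\<bar>\<theta>\<bar> + \<bar>r\<bar> + \<bar>\<phi>\<bar> \<in> horizontal_lengths g h"
    unfolding g h using length_straight[OF e(1), of r p] \<theta>(2)[of p] \<phi>(2)[of p'] e(2)
    by (intro horizontal_lengths_add) auto
  note mem = this
  then show ne: "horizontal_lengths g h \<noteq> {}"
    by blast
  have "sR_dist g h \<le> r + 2 * pi"
    using sR_dist_le[OF mem] \<theta>(1) \<phi>(1) by (simp add: r_def)
  then show "sR_dist g h \<le> norm (pos h - pos g) + 2 * pi"
    by (simp add: g h r_def)
  have "norm (pos h - pos g) \<le> L" if L: "L \<in> horizontal_lengths g h" for L
  proof -
    \<comment> \<open>With \<open>k = 0\<close> the gradient has the single component
      \<open>inner e (fst p)\<close>, of absolute value at most 1.\<close>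
    have "inner (calib 0 e) (h - g) \<le> 1 * L"
    proof (rule horizontal_lengths_inner_le[OF L])
      fix p assume "p \<in> SE2" 
      then have "\<bar>inner e (fst p)\<bar> \<le> 1"
        using Cauchy_Schwarz_ineq2[of e "fst p"] e by (simp add: SE2_iff)
      then show "grad_inner (calib 0 e) (calib 0 e) p \<le> 1\<^sup>2"
        by (simp add: grad_inner_def inner_calib X_theta_eq X_u_eq abs_le_square_iff[of _ 1, simplified] flip: power2_eq_square)
    qed simp
    moreover have "inner (calib 0 e) (h - g) = r"
      using e by (simp add: inner_diff_right inner_calib g h inner_add_right power2_norm_eq_inner[symmetric])
    ultimately show ?thesis
      by (simp add: g h r_def)
  qed
  then show "norm (pos h - pos g) \<le> sR_dist g h"
    unfolding sR_dist_def using ne by (intro cInf_greatest) auto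
qed

text \<open>Replaces the infimum by lengths converging to it, so that estimates for single curves
  pass to the limit.\<close>

lemma horizontal_lengths_seq:
  assumes "g \<in> SE2" "h \<in> SE2"
  obtains L where "\<And>n. L n \<in> horizontal_lengths g h" "L \<longlonglongrightarrow> sR_dist g h"
proof -
  have "\<exists>L\<in>horizontal_lengths g h. L < sR_dist g h + 1 / real (Suc n)" for n
    unfolding sR_dist_def using horizontal_lengths_nonempty[OF assms] bdd_below_horizontal_lengths
    by (subst cInf_less_iff[symmetric]) auto
  then obtain L where L: "\<And>n. L n \<in> horizontal_lengths g h" "\<And>n. L n < sR_dist g h + 1 / real (Suc n)"
    by metis
  have "L \<longlonglongrightarrow> sR_dist g h"
  proof (rule real_tendsto_sandwich[where f = "\<lambda>_. sR_dist g h" and h = "\<lambda>n. sR_dist g h + 1 / real (Suc n)"])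
    show "(\<lambda>n. sR_dist g h + 1 / real (Suc n)) \<longlonglongrightarrow> sR_dist g h"
      using tendsto_add[OF tendsto_const[of "sR_dist g h"] LIMSEQ_inverse_real_of_nat]
      by (simp add: inverse_eq_divide)
    show "\<forall>\<^sub>F n in sequentially. L n \<le> sR_dist g h + 1 / real (Suc n)"
      using L(2) by (auto intro: always_eventually less_imp_le)
    show "\<forall>\<^sub>F n in sequentially. sR_dist g h \<le> L n"
      using L(1) by (auto intro: always_eventually sR_dist_le)
  qed auto
  with that L show ?thesis by blast
qed

text \<open>The calibration inequality: the gradient has length 1 everywhere on the group, so no
  connecting curve is shorter than the increase of the functional.\<close>

lemma inner_calib_le_sR_dist:
  assumes "k\<^sup>2 = 1" "norm u = 1" "g \<in> SE2" "h \<in> SE2"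
  shows "inner (calib k u) (h - g) \<le> sR_dist g h"
proof -
  have "inner (calib k u) (h - g) \<le> L" if "L \<in> horizontal_lengths g h" for L
    using horizontal_lengths_inner_le[OF that, of 1 "calib k u"] grad_calib_self[OF assms(1,2)] by simp
  then show ?thesis
    unfolding sR_dist_def using horizontal_lengths_nonempty[OF assms(3,4)] by (intro cInf_greatest) auto
qed

section \<open>Calibrated geodesics\<close>

lemma hamiltonian_solution_iff:
  "hamiltonian_solution p\<theta> px py \<theta> x y \<longleftrightarrow>
    (\<forall>t. (\<theta> has_real_derivative p\<theta> t) (at t) \<and>
      (x has_real_derivative (px t * cos (\<theta> t) + py t * sin (\<theta> t)) * cos (\<theta> t)) (at t) \<and>
      (y has_real_derivative (px t * cos (\<theta> t) + py t * sin (\<theta> t)) * sin (\<theta> t)) (at t) \<and>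
      (p\<theta> has_real_derivative
        - ((px t * cos (\<theta> t) + py t * sin (\<theta> t)) * (py t * cos (\<theta> t) - px t * sin (\<theta> t)))) (at t) \<and>
      (px has_real_derivative 0) (at t) \<and> (py has_real_derivative 0) (at t))"
proof -
  have "deriv (\<lambda>s. H_sR s b c d e f) a = a"
    and "deriv (\<lambda>s. H_sR a s c d e f) b = (b * cos d + c * sin d) * cos d"
    and "deriv (\<lambda>s. H_sR a b s d e f) c = (b * cos d + c * sin d) * sin d"
    and "deriv (\<lambda>s. H_sR a b c s e f) d = (b * cos d + c * sin d) * (c * cos d - b * sin d)"
    and "deriv (\<lambda>s. H_sR a b c d s f) e = 0"
    and "deriv (\<lambda>s. H_sR a b c d e s) f = 0" for a b c d e f
    unfolding H_sR_def
    by (rule DERIV_imp_deriv; (auto intro!: derivative_eq_intros simp: algebra_simps power2_eq_square))+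
  then show ?thesis
    unfolding hamiltonian_solution_def by simp
qed

text \<open>With these momenta the velocity is the horizontal gradient of
  \<open>inner (calib k u)\<close>. The curve has unit speed, which bounds the distance above; the
  functional grows at unit rate along it, which bounds the distance below.\<close>

lemma calibrated_geodesic_is_metric_line:
  assumes lift: "arc_length_lift \<gamma> p\<theta> px py \<theta> x y"
    and u: "norm u = 1" and k: "k\<^sup>2 = 1"
    and px: "\<And>t. px t = Re u" and py: "\<And>t. py t = Im u"
    and p\<theta>: "\<And>t. p\<theta> t = k * inner u (\<i> * cis (\<theta> t))"
  shows "metric_line \<gamma>"
proof -
  define w where "w t = inner u (cis (\<theta> t))" for t
  have w: "w t = Re u * cos (\<theta> t) + Im u * sin (\<theta> t)" for t
    by (simp add: w_def inner_complex_def)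
  have ham: "(\<theta> has_real_derivative p\<theta> t) (at t)"
      "(x has_real_derivative w t * cos (\<theta> t)) (at t)"
      "(y has_real_derivative w t * sin (\<theta> t)) (at t)"
      "(p\<theta> has_real_derivative - (w t * (Im u * cos (\<theta> t) - Re u * sin (\<theta> t)))) (at t)" for t
    using lift unfolding arc_length_lift_def hamiltonian_solution_iff px py w by blast+
  define z p where "z t = cis (\<theta> t)" and "p t = Complex (x t) (y t)" for t
  have \<gamma>: "\<gamma> t = pt (z t) (p t)" for t
    using lift by (simp add: arc_length_lift_def se2_coords_def pt_def z_def p_def)
  have unit: "(p\<theta> t)\<^sup>2 + (w t)\<^sup>2 = 1" for t
    using inner_i_square[of "cis (\<theta> t)" u] u k by (simp add: p\<theta> w_def power_mult_distrib)
  have "isCont p\<theta> t" "isCont \<theta> t" for t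
    using DERIV_isCont[OF ham(4)] DERIV_isCont[OF ham(1)] by auto
  then have cont: "continuous_on UNIV p\<theta>" "continuous_on UNIV w"
    unfolding w by (auto intro!: continuous_intros continuous_at_imp_continuous_on)
  have dz: "(z has_vector_derivative (p\<theta> t *\<^sub>R (\<i> * z t))) (at t)" for t
    using has_derivative_cis[OF ham(1)[of t, unfolded has_field_derivative_def]]
    by (simp add: z_def[abs_def] has_vector_derivative_def mult.commute)
  have dp: "(p has_vector_derivative (w t *\<^sub>R z t)) (at t)" for t
    using ham(2,3)[of t] by (simp add: p_def[abs_def] z_def has_vector_derivative_complex_iff
        has_real_derivative_iff_has_vector_derivative)
  have "sR_dist (\<gamma> a) (\<gamma> b) = b - a" if ab: "a \<le> b" for a b
  proof (rule antisym)
    have "1 * (b - a) \<in> horizontal_lengths (\<gamma> a) (\<gamma> b)"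
      unfolding \<gamma> by (rule const_speed_length[OF dz dp _ cont]) (use ab unit in \<open>auto simp: z_def\<close>)
    then show "sR_dist (\<gamma> a) (\<gamma> b) \<le> b - a"
      using sR_dist_le by simp
  next
    \<comment> \<open>The calibration functional minus time; its derivative is
      \<open>p\<theta>\<^sup>2 + w\<^sup>2 - 1\<close>, which vanishes.\<close>
    define f where "f t = inner (calib k u) (\<gamma> t) - t" for t
    have f: "f t = k * (Re u * cos (\<theta> t) + Im u * sin (\<theta> t)) + Re u * x t + Im u * y t - t" for t
      by (simp add: f_def inner_calib \<gamma> z_def p_def inner_complex_def)
    have "(f has_real_derivative 0) (at t)" for t
    proof -
      have "p\<theta> t * p\<theta> t + w t * w t = 1"
        using unit[of t] by (simp add: power2_eq_square)
      moreover have "k * (Im u * cos (\<theta> t) - Re u * sin (\<theta> t)) = p\<theta> t"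
        by (simp add: p\<theta> inner_complex_def)
      ultimately have "k * (Im u * cos (\<theta> t) - Re u * sin (\<theta> t)) * p\<theta> t
          + (Re u * cos (\<theta> t) + Im u * sin (\<theta> t)) * w t - 1 = 0"
        by (simp add: w[symmetric])
      then show ?thesis
        unfolding f[abs_def]
        by (auto intro!: derivative_eq_intros ham simp: algebra_simps)
    qed
    then have "f b = f a"
      using DERIV_isconst_all by blast
    then show "b - a \<le> sR_dist (\<gamma> a) (\<gamma> b)"
      using inner_calib_le_sR_dist[OF k u, of "\<gamma> a" "\<gamma> b"]
      by (simp add: f_def inner_diff_right) (simp add: \<gamma> z_def SE2_iff)
  qed
  then show ?thesis
    by (simp add: metric_line_def)
qed

text \<open>A Gronwall argument: since \<open>\<bar>a t\<bar> \<le> 1\<close>,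
  \<open>exp (- 2 * t) * (D t)\<^sup>2\<close> does not increase after time 0 and
  \<open>exp (2 * t) * (D t)\<^sup>2\<close> does not decrease before it.\<close>

lemma linear_ode_zero:
  fixes D a :: "real \<Rightarrow> real"
  assumes D: "\<And>t. (D has_real_derivative a t * D t) (at t)"
    and a: "\<And>t. \<bar>a t\<bar> \<le> 1" and D0: "D 0 = 0"
  shows "D t = 0"
proof (cases "0 \<le> t")
  case True
  have "exp (- 2 * t) * (D t)\<^sup>2 \<le> exp (- 2 * 0) * (D 0)\<^sup>2"
  proof (rule DERIV_nonpos_imp_nonincreasing[OF True])
    fix s
    have "((\<lambda>t. exp (- 2 * t) * (D t)\<^sup>2) has_real_derivative exp (- 2 * s) * (D s)\<^sup>2 * (2 * (a s - 1))) (at s)"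
      by (auto intro!: derivative_eq_intros D simp: algebra_simps power2_eq_square)
    moreover have "exp (- 2 * s) * (D s)\<^sup>2 * (2 * (a s - 1)) \<le> 0"
      using a[of s] by (intro mult_nonneg_nonpos) auto
    ultimately show "\<exists>y. ((\<lambda>t. exp (- 2 * t) * (D t)\<^sup>2) has_real_derivative y) (at s) \<and> y \<le> 0"
      by blast
  qed
  then show ?thesis
    using D0 by (simp add: mult_le_0_iff)
next
  case False
  then have t: "t \<le> 0" by simp
  have "exp (2 * t) * (D t)\<^sup>2 \<le> exp (2 * 0) * (D 0)\<^sup>2"
  proof (rule DERIV_nonneg_imp_nondecreasing[OF t])
    fix s
    have "((\<lambda>t. exp (2 * t) * (D t)\<^sup>2) has_real_derivative exp (2 * s) * (D s)\<^sup>2 * (2 * (a s + 1))) (at s)"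
      by (auto intro!: derivative_eq_intros D simp: algebra_simps power2_eq_square)
    moreover have "exp (2 * s) * (D s)\<^sup>2 * (2 * (a s + 1)) \<ge> 0"
      using a[of s] by (intro mult_nonneg_nonneg) auto
    ultimately show "\<exists>y. ((\<lambda>t. exp (2 * t) * (D t)\<^sup>2) has_real_derivative y) (at s) \<and> y \<ge> 0"
      by blast
  qed
  then show ?thesis
    using D0 by (simp add: mult_le_0_iff)
qed

text \<open>Vanishing \<open>p\<theta>\<close> forces \<open>w * m = 0\<close>, and the energy gives
  \<open>w\<^sup>2 = 1\<close>. So \<open>m = 0\<close>, \<open>u\<close> is a unit vector, and the
  calibration condition \<open>p\<theta> = k * m\<close> reads 0 = 0.\<close>

lemma type_line_is_metric_line:
  assumes "geodesic_type_line \<gamma>"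
  shows "metric_line \<gamma>"
proof -
  obtain p\<theta> px py \<theta> x y where lift: "arc_length_lift \<gamma> p\<theta> px py \<theta> x y" and d0: "\<And>t. deriv \<theta> t = 0"
    using assms unfolding geodesic_type_line_def by blast
  define w m where "w t = px t * cos (\<theta> t) + py t * sin (\<theta> t)"
    and "m t = py t * cos (\<theta> t) - px t * sin (\<theta> t)" for t
  have ham: "(\<theta> has_real_derivative p\<theta> t) (at t)" "(p\<theta> has_real_derivative - (w t * m t)) (at t)"
      "(px has_real_derivative 0) (at t)" "(py has_real_derivative 0) (at t)" for t
    using lift unfolding arc_length_lift_def hamiltonian_solution_iff w_def m_def by blast+
  have p0: "p\<theta> t = 0" for t
    using DERIV_imp_deriv[OF ham(1)] d0 by simp
  then have "p\<theta> = (\<lambda>_. 0)"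
    by blast
  then have wm: "w t * m t = 0" for t
    using ham(2)[of t] DERIV_unique[of "\<lambda>_. 0 :: real" 0 t "- (w t * m t)"] by simp
  have w1: "(w t)\<^sup>2 = 1" for t
    using lift p0 by (simp add: arc_length_lift_def H_sR_def w_def)
  have m0: "m t = 0" for t
    using wm[of t] w1[of t] by auto
  define u where "u = Complex (px 0) (py 0)"
  have px: "px t = Re u" and py: "py t = Im u" for t
    using DERIV_isconst_all[of px t 0] DERIV_isconst_all[of py t 0] ham(3,4) by (auto simp: u_def)
  have m: "m t = inner u (\<i> * cis (\<theta> t))" for t
    by (simp add: m_def px py inner_complex_def)
  have "w t = inner u (cis (\<theta> t))" for t
    by (simp add: w_def px py inner_complex_def)
  then have "(norm u)\<^sup>2 = 1"
    using inner_i_square[of "cis (\<theta> 0)" u] w1[of 0] m0[of 0] m[of 0] by simp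
  then have "norm u = 1"
    using power2_eq_1_iff[of "norm u"] norm_ge_zero[of u] by linarith
  from calibrated_geodesic_is_metric_line[OF lift this, of 1] show ?thesis
    using px py m m0 p0 by simp
qed

text \<open>Energy 1/2 and \<open>R = 1\<close> give \<open>p\<theta>\<^sup>2 = m\<^sup>2\<close> at
  time 0, hence \<open>p\<theta> = k * m\<close> there for a sign \<open>k\<close>. The linear
  equation for the difference carries this sign to all times.\<close>

lemma type_heteroclinic_is_metric_line:
  assumes "geodesic_type_heteroclinic \<gamma>"
  shows "metric_line \<gamma>"
proof -
  obtain p\<theta> px py \<theta> x y \<delta> where lift: "arc_length_lift \<gamma> p\<theta> px py \<theta> x y" and mom: "has_momentum px py 1 \<delta>"
    using assms unfolding geodesic_type_heteroclinic_def by blast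
  define u where "u = cis \<delta>"
  have px: "px t = Re u" and py: "py t = Im u" and u: "norm u = 1" for t
    using mom by (simp_all add: has_momentum_def u_def)
  define w m where "w t = Re u * cos (\<theta> t) + Im u * sin (\<theta> t)"
    and "m t = Im u * cos (\<theta> t) - Re u * sin (\<theta> t)" for t
  have ham: "(\<theta> has_real_derivative p\<theta> t) (at t)" "(p\<theta> has_real_derivative - (w t * m t)) (at t)" for t
    using lift unfolding arc_length_lift_def hamiltonian_solution_iff w_def m_def px py by blast+
  have w: "w t = inner u (cis (\<theta> t))" and m: "m t = inner u (\<i> * cis (\<theta> t))" for t
    by (simp_all add: w_def m_def inner_complex_def)
  have mw: "(m t)\<^sup>2 + (w t)\<^sup>2 = 1" for t
    using inner_i_square[of "cis (\<theta> t)" u] u by (simp add: w m)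
  have "H_sR (p\<theta> 0) (px 0) (py 0) (\<theta> 0) (x 0) (y 0) = 1/2"
    using lift unfolding arc_length_lift_def by blast
  then have "(p\<theta> 0)\<^sup>2 + (w 0)\<^sup>2 = 1"
    by (simp add: H_sR_def w_def px py)
  then have "(p\<theta> 0)\<^sup>2 = (m 0)\<^sup>2"
    using mw[of 0] by simp
  then obtain k :: real where k: "k\<^sup>2 = 1" "p\<theta> 0 = k * m 0"
    unfolding power2_eq_iff by (metis mult_1 mult_minus1 one_power2 power2_minus)
  define D where "D t = p\<theta> t - k * m t" for t
  have "D t = 0" for t
  proof (rule linear_ode_zero[where D = D and a = "\<lambda>t. k * w t"])
    show "(D has_real_derivative (k * w t) * D t) (at t)" for t
    proof -
      have dm: "(m has_real_derivative - w t * p\<theta> t) (at t)"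
        unfolding m_def[abs_def] w_def by (auto intro!: derivative_eq_intros ham simp: algebra_simps)
      have kk: "k * (k * a) = a" for a
        using k(1) by (simp add: power2_eq_square flip: mult.assoc)
      show ?thesis
        unfolding D_def by (auto intro!: derivative_eq_intros ham dm simp: algebra_simps kk)
    qed
    have "(k * w t)\<^sup>2 \<le> 1" for t
      using mw[of t] k zero_le_power2[of "m t"] unfolding power_mult_distrib k(1) by linarith
    then show "\<bar>k * w t\<bar> \<le> 1" for t
      by (metis abs_square_le_1)
  qed (simp add: D_def k)
  then show ?thesis
    by (intro calibrated_geodesic_is_metric_line[OF lift u k(1) px py]) (simp add: D_def m)
qed

section \<open>Integral curves of the calibrated gradient\<close>

text \<open>The horizontal gradient of \<open>inner (calib k u)\<close> as an ambient
  vector.\<close>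

definition calib_field :: "real \<Rightarrow> complex \<Rightarrow> se2 \<Rightarrow> se2" where
  "calib_field k u g =
    inner (calib k u) (X_theta g) *\<^sub>R X_theta g + inner (calib k u) (X_u g) *\<^sub>R X_u g"

text \<open>Along an integral curve \<open>u\<close> serves as the constant momentum and the angular
  velocity \<open>a\<close> as \<open>p\<theta>\<close>; Hamilton's equations hold once the angle is
  lifted to the real line.\<close>

lemma calib_field_integral_curve:
  assumes SE2: "\<And>t. \<gamma> t \<in> SE2" and u: "norm u = 1" and k: "k\<^sup>2 = 1"
    and der: "\<And>t. (\<gamma> has_vector_derivative calib_field k u (\<gamma> t)) (at t)"
  shows "geodesic_type_line \<gamma> \<or> geodesic_type_heteroclinic \<gamma>"
proof -
  define z p where "z t = fst (\<gamma> t)" and "p t = pos (\<gamma> t)" for t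
  have \<gamma>: "\<gamma> t = pt (z t) (p t)" for t
    by (simp add: z_def p_def)
  have nz: "norm (z t) = 1" for t
    using SE2 by (simp add: SE2_iff z_def)
  have field: "calib_field k u (pt z p) = pt ((k * inner u (\<i> * z)) *\<^sub>R (\<i> * z)) (inner u z *\<^sub>R z)" for z p
    by (simp add: calib_field_def X_theta_pt X_u_pt inner_calib pt_scaleR pt_add)
  define a where "a t = k * inner u (\<i> * z t)" for t
  have blpos: "bounded_linear pos"
  proof -
    have "pos = (\<lambda>g. of_real (fst (snd g)) + \<i> * of_real (snd (snd g)))"
      by (auto simp: pos_def complex_eq_iff)
    moreover have "bounded_linear (\<lambda>g :: se2. of_real (fst (snd g)) + \<i> * of_real (snd (snd g)) :: complex)"
      by (intro bounded_linear_add bounded_linear_const_mult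
          bounded_linear_compose[OF bounded_linear_of_real]
          bounded_linear_compose[OF bounded_linear_fst] bounded_linear_compose[OF bounded_linear_snd]
          bounded_linear_ident)
    ultimately show ?thesis by simp
  qed
  have dz: "(z has_vector_derivative (a t *\<^sub>R (\<i> * z t))) (at t)" for t
    using bounded_linear.has_vector_derivative[OF bounded_linear_fst der[of t]]
    unfolding \<gamma>[of t] field by (simp add: z_def[abs_def] a_def)
  have dp: "(p has_vector_derivative (inner u (z t) *\<^sub>R z t)) (at t)" for t
    using bounded_linear.has_vector_derivative[OF blpos der[of t]]
    unfolding \<gamma>[of t] field by (simp add: p_def[abs_def] z_def)
  have "isCont a t" for t
    unfolding a_def by (intro continuous_intros has_vector_derivative_continuous[OF dz])
  \<comment> \<open>An antiderivative \<open>F\<close> of the angular velocity is a lift of the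
    angle up to a constant, because \<open>z t * cis (- F t)\<close> has derivative 0.\<close>
  then obtain F where F: "\<And>t. (F has_vector_derivative a t) (at t)"
    using einterval_antiderivative[of "-\<infinity>" "\<infinity>" a] by auto
  then have F': "(F has_real_derivative a t) (at t)" for t
    by (simp add: has_real_derivative_iff_has_vector_derivative)
  have dF: "((\<lambda>t. cis (- F t)) has_vector_derivative (- a t *\<^sub>R (\<i> * cis (- F t)))) (at t)" for t
  proof -
    have "((\<lambda>t. - F t) has_derivative (\<lambda>s. - (a t * s))) (at t)"
      using F'[of t] unfolding has_field_derivative_def by (rule has_derivative_minus)
    from has_derivative_cis[OF this] show ?thesis
      by (simp add: has_vector_derivative_def mult.commute)
  qed
  have "((\<lambda>t. z t * cis (- F t)) has_vector_derivative 0) (at t)" for t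
    using has_vector_derivative_mult[OF dz dF, of t] by (simp add: algebra_simps)
  then obtain h where h: "\<And>t. z t * cis (- F t) = h"
    using has_derivative_zero_constant[OF convex_UNIV, of "\<lambda>t. z t * cis (- F t)"]
    by (auto simp: has_vector_derivative_def)
  have "norm h = 1"
    using h[of 0] nz[of 0] by (metis mult_1 norm_cis norm_mult)
  then obtain \<alpha> where \<alpha>: "h = cis \<alpha>"
    using cis_Arg[of h] that[of "Arg h"] by (cases "h = 0") (auto simp: sgn_div_norm)
  define \<theta> where "\<theta> t = F t + \<alpha>" for t
  have z: "z t = cis (\<theta> t)" for t
  proof -
    have "z t = (z t * cis (- F t)) * cis (F t)"
      by (simp add: mult.assoc cis_mult)
    then show ?thesis
      by (simp only: h \<alpha> cis_mult \<theta>_def add.commute)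
  qed
  define x y where "x t = Re (p t)" and "y t = Im (p t)" for t
  have d\<theta>: "(\<theta> has_real_derivative a t) (at t)" for t
    unfolding \<theta>_def by (auto intro!: derivative_eq_intros F')
  have a: "a t = k * (Im u * cos (\<theta> t) - Re u * sin (\<theta> t))" for t
    by (simp add: a_def z inner_complex_def)
  have da: "(a has_real_derivative
      - ((Re u * cos (\<theta> t) + Im u * sin (\<theta> t)) * (Im u * cos (\<theta> t) - Re u * sin (\<theta> t)))) (at t)" for t
  proof -
    have kk: "k * (k * b) = b" for b
      using k by (simp add: power2_eq_square flip: mult.assoc)
    show ?thesis
      unfolding a[abs_def] by (auto intro!: derivative_eq_intros d\<theta> simp: a algebra_simps kk)
  qed
  have dxy: "(x has_real_derivative (Re u * cos (\<theta> t) + Im u * sin (\<theta> t)) * cos (\<theta> t)) (at t)"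
    "(y has_real_derivative (Re u * cos (\<theta> t) + Im u * sin (\<theta> t)) * sin (\<theta> t)) (at t)" for t
    using dp[of t] unfolding has_vector_derivative_complex_iff x_def y_def
    by (simp_all add: z inner_complex_def has_real_derivative_iff_has_vector_derivative)
  have "hamiltonian_solution a (\<lambda>_. Re u) (\<lambda>_. Im u) \<theta> x y"
    unfolding hamiltonian_solution_iff using d\<theta> da dxy by simp
  moreover have "H_sR (a t) (Re u) (Im u) (\<theta> t) (x t) (y t) = 1/2" for t
    using inner_i_square[OF nz[of t], of u] u k
    by (simp add: H_sR_def a_def power_mult_distrib z inner_complex_def)
  moreover have "\<gamma> t = se2_coords (\<theta> t) (x t) (y t)" for t
    unfolding \<gamma> by (simp add: pt_def z se2_coords_def x_def y_def)
  ultimately have lift: "arc_length_lift \<gamma> a (\<lambda>_. Re u) (\<lambda>_. Im u) \<theta> x y"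
    unfolding arc_length_lift_def by blast
  \<comment> \<open>Since \<open>R = 1\<close>, whether \<open>deriv \<theta>\<close> vanishes
    identically decides between the two types.\<close>
  have "u = cis (Arg u)"
    using cis_Arg[of u] u by (cases "u = 0") (auto simp: sgn_div_norm)
  then have "has_momentum (\<lambda>_. Re u) (\<lambda>_. Im u) 1 (Arg u)"
    unfolding has_momentum_def by (metis cis.sel mult_1 zero_le_one)
  then show ?thesis
    unfolding geodesic_type_line_def geodesic_type_heteroclinic_def using lift by blast
qed

section \<open>Infinitesimal consequences of calibration\<close>

text \<open>The competitor turns to the heading \<open>s *\<^sub>R e\<close>, drives straight and
  turns to the final heading. If \<open>s' = - s\<close>, a heteroclinic arc is inserted: its length
  \<open>2 * T\<close> exceeds its displacement by \<open>2 * tanh T\<close>, at most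
  \<open>1 - s * s' = 2\<close>. The small turns cost at most \<open>8 * \<eta>\<close> in
  all.\<close>

lemma sR_dist_near_calibrated_le:
  assumes g: "g \<in> SE2" and h: "h \<in> SE2" and e: "norm e = 1" and r: "pos h = pos g + r *\<^sub>R e"
    and s: "s\<^sup>2 = 1" and s': "s'\<^sup>2 = 1" and \<eta>: "\<eta> \<le> 1/8"
    and z: "norm (fst g - s *\<^sub>R e) \<le> \<eta>" and z': "norm (fst h - s' *\<^sub>R e) \<le> \<eta>"
    and T: "0 \<le> T" "2 * T \<le> r" and ET: "norm (Complex (tanh T) (1 / cosh T) - 1) \<le> \<eta>"
  shows "sR_dist g h \<le> r + (1 - s * s') + 8 * \<eta>"
proof -
  have r0: "0 \<le> r"
    using T by simp
  \<comment> \<open>The linear bound on the angle holds for distances below 1/2; the turns have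
    \<open>d\<close> equal to \<open>\<eta>\<close> or \<open>2 * \<eta>\<close>, and
    \<open>\<eta> \<le> 1/8\<close> keeps this at most 1/4.\<close>
  have rot: "\<exists>L \<le> 2 * d. \<forall>p. L \<in> horizontal_lengths (pt a p) (pt b p)"
    if ab: "norm a = 1" "norm b = 1" "norm (b - a) \<le> d" "d \<le> 1/4" for a b :: complex and d
  proof -
    obtain \<theta> where \<theta>: "\<And>p. \<bar>\<theta>\<bar> \<in> horizontal_lengths (pt a p) (pt b p)"
      "norm (b - a) < 1/2 \<longrightarrow> \<bar>\<theta>\<bar> \<le> 2 * norm (b - a)"
      by (rule ex_length_rotation[OF ab(1,2)]) blast
    then show ?thesis
      using ab(3,4) by (intro exI[of _ "\<bar>\<theta>\<bar>"]) auto
  qed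
  have nz: "norm (fst g) = 1" "norm (fst h) = 1"
    using g h by (simp_all add: SE2_iff)
  have ns: "\<bar>s\<bar> = 1" "\<bar>s'\<bar> = 1" "s * s = 1"
    using s s' by (auto simp: power2_eq_1_iff)
  have nse: "norm (s *\<^sub>R e) = 1"
    using e ns by simp
  obtain L1 where L1: "L1 \<le> 2 * \<eta>" "\<And>p. L1 \<in> horizontal_lengths (pt (fst g) p) (pt (s *\<^sub>R e) p)"
    using rot[OF nz(1) nse, of \<eta>] z \<eta> by (auto simp: norm_minus_commute)
  \<comment> \<open>The heading is \<open>s *\<^sub>R e\<close>, so moving by \<open>l\<close> along
    \<open>e\<close> means driving by \<open>l * s\<close>.\<close>
  have straight: "\<bar>l\<bar> \<in> horizontal_lengths (pt (s *\<^sub>R e) p) (pt (s *\<^sub>R e) (p + l *\<^sub>R e))" for l p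
    using length_straight[OF nse, of "l * s" p] ns by (simp add: abs_mult mult.assoc)
  have gh: "g = pt (fst g) (pos g)" "h = pt (fst h) (pos g + r *\<^sub>R e)"
    using r by (simp_all flip: r)
  show ?thesis
  proof (cases "s' = s")
    case True
    obtain L2 where L2: "L2 \<le> 2 * \<eta>" "\<And>p. L2 \<in> horizontal_lengths (pt (s *\<^sub>R e) p) (pt (fst h) p)"
      using rot[OF nse nz(2), of \<eta>] z' \<eta> True by auto
    have "L1 + \<bar>r\<bar> + L2 \<in> horizontal_lengths (pt (fst g) (pos g)) (pt (fst h) (pos g + r *\<^sub>R e))"
      by (intro horizontal_lengths_add[OF horizontal_lengths_add[OF L1(2) straight] L2(2)])
    from sR_dist_le[OF this] show ?thesis
      using L1 L2 r0 True ns order_trans[OF norm_ge_zero z] by (simp flip: gh)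
  next
    case False
    then have s'eq: "s' = - s"
      using s s' by (auto simp: power2_eq_1_iff)
    define E where "E = Complex (tanh T) (1 / cosh T)"
    define E' where "E' = Complex (- tanh T) (1 / cosh T)"
    have nE: "norm E = 1" "norm E' = 1"
      using heteroclinic_norm[of T] by (simp_all add: E_def E'_def cmod_def)
    have E1: "norm (E' + 1) = norm (E - 1)"
      by (simp add: E_def E'_def cmod_def power2_commute)
    obtain L2 where L2: "L2 \<le> 2 * \<eta>" "\<And>p. L2 \<in> horizontal_lengths (pt (s *\<^sub>R e) p) (pt (s *\<^sub>R (e * E)) p)"
    proof -
      have "s *\<^sub>R (e * E) - s *\<^sub>R e = s *\<^sub>R (e * (E - 1))"
        by (simp add: algebra_simps)
      then have "norm (s *\<^sub>R (e * E) - s *\<^sub>R e) \<le> \<eta>"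
        using ET ns e by (simp add: norm_mult E_def)
      then show ?thesis
        using rot[OF nse, of "s *\<^sub>R (e * E)" \<eta>] \<eta> ns e nE that by (auto simp: norm_mult)
    qed
    obtain L3 where L3: "L3 \<le> 2 * (2 * \<eta>)" "\<And>p. L3 \<in> horizontal_lengths (pt (s *\<^sub>R (e * E')) p) (pt (fst h) p)"
    proof -
      have "s *\<^sub>R (e * E') - s' *\<^sub>R e = s *\<^sub>R (e * (E' + 1))"
        by (simp add: s'eq algebra_simps)
      then have "norm (s *\<^sub>R (e * E') - s' *\<^sub>R e) \<le> \<eta>"
        using ET ns e E1 by (simp add: norm_mult E_def)
      then have "norm (fst h - s *\<^sub>R (e * E')) \<le> 2 * \<eta>"
        using z' norm_triangle_ineq4[of "fst h - s' *\<^sub>R e" "s *\<^sub>R (e * E') - s' *\<^sub>R e"] by simp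
      then show ?thesis
        using rot[OF _ nz(2), of "s *\<^sub>R (e * E')" "2 * \<eta>"] \<eta> ns e nE that by (auto simp: norm_mult)
    qed
    \<comment> \<open>The straight piece covers what the heteroclinic arc leaves of
      \<open>r\<close>; \<open>2 * T \<le> r\<close> makes it nonnegative.\<close>
    define l where "l = r - (2 * T - 2 * tanh T)"
    have t01: "0 \<le> tanh T" "tanh T \<le> 1"
      using T(1) tanh_real_lt_1[of T] by (auto simp: less_imp_le)
    have het: "2 * T \<in> horizontal_lengths (pt (s *\<^sub>R (e * E)) (pos g + l *\<^sub>R e))
        (pt (s *\<^sub>R (e * E')) (pos g + r *\<^sub>R e))"
      using length_heteroclinic[OF e T(1) s, of "pos g + l *\<^sub>R e"]
      by (simp add: E_def E'_def l_def algebra_simps)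
    have "L1 + \<bar>l\<bar> + L2 + 2 * T + L3 \<in> horizontal_lengths (pt (fst g) (pos g)) (pt (fst h) (pos g + r *\<^sub>R e))"
      by (intro horizontal_lengths_add[OF horizontal_lengths_add[OF horizontal_lengths_add[OF
              horizontal_lengths_add[OF L1(2) straight] L2(2)] het] L3(2)])
    from sR_dist_le[OF this] have "sR_dist g h \<le> L1 + \<bar>l\<bar> + L2 + 2 * T + L3"
      by (simp flip: gh)
    moreover have "\<bar>l\<bar> = l"
      using T t01 unfolding l_def by linarith
    ultimately show ?thesis
      using L1(1) L2(1) L3(1) t01 ns(3) by (simp add: s'eq l_def)
  qed
qed

text \<open>The squared distance of this unit vector to 1 is \<open>2 - 2 * tanh T\<close>, and
  \<open>tanh\<close> tends to 1.\<close>

lemma ex_heteroclinic_time: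
  assumes "0 < \<eta>"
  obtains T where "0 \<le> T" "norm (Complex (tanh T) (1 / cosh T) - 1) \<le> \<eta>"
proof -
  have "\<forall>\<^sub>F T :: real in at_top. 1 - \<eta>\<^sup>2 / 2 < tanh T"
    using assms by (intro order_tendstoD(1)[OF tanh_real_at_top]) auto
  then obtain T :: real where T: "0 \<le> T" "1 - \<eta>\<^sup>2 / 2 < tanh T"
    using eventually_conj[OF eventually_ge_at_top[of 0]] by (metis (lifting) eventually_happens trivial_limit_at_top_linorder)
  have "(tanh T)\<^sup>2 + (1 / cosh T)\<^sup>2 = 1"
    using heteroclinic_norm[of T] by (simp add: cmod_def)
  then have "(norm (Complex (tanh T) (1 / cosh T) - 1))\<^sup>2 = 2 - 2 * tanh T"
    unfolding cmod_power2 by (simp add: power2_diff)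
  also have "\<dots> \<le> \<eta>\<^sup>2"
    using T by simp
  finally have "norm (Complex (tanh T) (1 / cosh T) - 1) \<le> \<eta>"
    by (rule power2_le_imp_le) (use assms in simp)
  with T that show ?thesis by blast
qed

section \<open>First-order behaviour of calibrated curves\<close>

lemma norm_le_sR_dist:
  assumes "g \<in> SE2" "h \<in> SE2"
  shows "norm (h - g) \<le> sR_dist g h"
proof -
  have "norm (h - g) \<le> L" if "L \<in> horizontal_lengths g h" for L
    using that horizontal_norm_le unfolding horizontal_lengths_def
    by (smt (verit) atLeastAtMost_iff mem_Collect_eq)
  then show ?thesis
    unfolding sR_dist_def using horizontal_lengths_nonempty[OF assms] by (intro cInf_greatest) auto
qed

lemma inner_calib_field: "inner q (calib_field k u g) = grad_inner (calib k u) q g"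
  by (simp add: calib_field_def grad_inner_def inner_add_right)

text \<open>Testing the difference against itself reduces to the Lipschitz bound for
  \<open>grad_inner\<close>.\<close>

lemma calib_field_lipschitz:
  assumes "g \<in> SE2" "h \<in> SE2"
  shows "norm (calib_field k u g - calib_field k u h) \<le> 4 * norm (calib k u) * norm (g - h)"
proof -
  define D where "D = calib_field k u g - calib_field k u h"
  have "inner D D = grad_inner (calib k u) D g - grad_inner (calib k u) D h"
    by (simp add: D_def inner_calib_field[symmetric] inner_diff_right)
  also have "\<dots> \<le> 4 * norm (calib k u) * norm D * norm (g - h)"
    using grad_inner_lipschitz[OF assms, of "calib k u" D] by simp
  finally have "norm D * norm D \<le> norm D * (4 * norm (calib k u) * norm (g - h))"
    by (simp add: power2_norm_eq_inner[symmetric] power2_eq_square mult_ac)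
  then show ?thesis
    by (cases "norm D = 0") (auto simp: D_def)
qed

text \<open>A first variation: the functional of \<open>calib k u + \<epsilon> *\<^sub>R q\<close>
  grows by at most the length times a bound on its gradient. By \<open>cal\<close> the terms of
  order 0 agree in the limit, so those of order \<epsilon> give the claim; the last summand accounts
  for the change of the gradient near \<open>g\<close>.\<close>

lemma calibrated_inner_le:
  assumes g: "g \<in> SE2" and h: "h \<in> SE2" and u: "norm u = 1" and k: "k\<^sup>2 = 1"
    and cal: "inner (calib k u) (h - g) = sR_dist g h"
  shows "inner q (h - g) \<le>
    sR_dist g h * (grad_inner (calib k u) q g + 4 * norm (calib k u) * norm q * sR_dist g h)"
proof -
  define c where "c = calib k u"
  define \<tau> where "\<tau> = sR_dist g h"
  define G where "G = grad_inner c q g"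
  define M where "M = 4 * norm c * norm q"
  have M0: "0 \<le> M"
    by (simp add: M_def)
  obtain L where L: "\<And>n. L n \<in> horizontal_lengths g h" and lim: "L \<longlonglongrightarrow> \<tau>"
    using horizontal_lengths_seq[OF g h] unfolding \<tau>_def by metis
  have L0: "0 \<le> L n" for n
    using horizontal_lengths_nonneg[OF L] .
  have step: "\<tau> + \<epsilon> * inner q (h - g) \<le> (1 + \<epsilon> * (G + M * L n) + \<epsilon>\<^sup>2 * (norm q)\<^sup>2 / 2) * L n"
    if \<epsilon>: "0 < \<epsilon>" for \<epsilon> n
  proof -
    \<comment> \<open>The squared gradient length is at most
      \<open>1 + 2 * \<mu> \<le> (1 + \<mu>)\<^sup>2\<close>, which bounds the length without a
      root.\<close>
    define \<mu> where "\<mu> = \<epsilon> * (G + M * L n) + \<epsilon>\<^sup>2 * (norm q)\<^sup>2 / 2"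
    have bound: "grad_inner (c + \<epsilon> *\<^sub>R q) (c + \<epsilon> *\<^sub>R q) p \<le> 1 + 2 * \<mu>"
      if p: "p \<in> SE2" "norm (p - g) \<le> L n" for p
    proof -
      have "grad_inner (c + \<epsilon> *\<^sub>R q) (c + \<epsilon> *\<^sub>R q) p
          = grad_inner c c p + 2 * \<epsilon> * grad_inner c q p + \<epsilon>\<^sup>2 * grad_inner q q p"
        by (simp add: grad_inner_def inner_add_left power2_eq_square algebra_simps)
      moreover have "grad_inner c c p = 1"
        unfolding c_def by (rule grad_calib_self[OF k u p(1)])
      moreover have "\<epsilon>\<^sup>2 * grad_inner q q p \<le> \<epsilon>\<^sup>2 * (norm q)\<^sup>2"
        by (intro mult_left_mono grad_inner_self_le p) simp
      moreover have "grad_inner c q p \<le> G + M * L n"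
        using grad_inner_lipschitz[OF p(1) g, of c q] mult_left_mono[OF p(2) M0]
        by (simp add: G_def M_def)
      then have "2 * \<epsilon> * grad_inner c q p \<le> 2 * \<epsilon> * (G + M * L n)"
        using \<epsilon> by simp
      ultimately show ?thesis
        unfolding \<mu>_def by (simp add: algebra_simps)
    qed
    \<comment> \<open>\<open>1 + 2 * \<mu>\<close> dominates a sum of squares at \<open>g\<close>,
      so \<open>1 + \<mu>\<close> is nonnegative even where \<open>G\<close> is negative.\<close>
    have "0 \<le> grad_inner (c + \<epsilon> *\<^sub>R q) (c + \<epsilon> *\<^sub>R q) g"
      by (simp add: grad_inner_def)
    also have "\<dots> \<le> 1 + 2 * \<mu>"
      by (rule bound[OF g]) (simp add: L0)
    finally have \<mu>: "0 \<le> 1 + \<mu>"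
      by simp
    have "1 + 2 * \<mu> \<le> (1 + \<mu>)\<^sup>2"
      by (simp add: power2_eq_square algebra_simps)
    then have "inner (c + \<epsilon> *\<^sub>R q) (h - g) \<le> (1 + \<mu>) * L n"
      by (intro horizontal_lengths_inner_le[OF L \<mu>] order_trans[OF bound])
    then show ?thesis
      using cal by (simp add: inner_add_left c_def \<tau>_def \<mu>_def add.assoc)
  qed
  have step': "inner q (h - g) \<le> (G + M * \<tau>) * \<tau> + \<epsilon> * ((norm q)\<^sup>2 / 2 * \<tau>)" if \<epsilon>: "0 < \<epsilon>" for \<epsilon>
  proof -
    \<comment> \<open>First \<open>n\<close> tends to infinity, which makes the terms of order 0
      equal to \<open>\<tau>\<close> on both sides; then \<epsilon> is divided out and sent to
      0.\<close>
    have "(\<lambda>n. (1 + \<epsilon> * (G + M * L n) + \<epsilon>\<^sup>2 * (norm q)\<^sup>2 / 2) * L n)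
        \<longlonglongrightarrow> (1 + \<epsilon> * (G + M * \<tau>) + \<epsilon>\<^sup>2 * (norm q)\<^sup>2 / 2) * \<tau>"
      by (intro tendsto_intros lim)
    from LIMSEQ_le_const[OF this] have "\<tau> + \<epsilon> * inner q (h - g)
        \<le> (1 + \<epsilon> * (G + M * \<tau>) + \<epsilon>\<^sup>2 * (norm q)\<^sup>2 / 2) * \<tau>"
      using step[OF \<epsilon>] by blast
    then have "\<epsilon> * inner q (h - g) \<le> \<epsilon> * ((G + M * \<tau>) * \<tau> + \<epsilon> * ((norm q)\<^sup>2 / 2 * \<tau>))"
      by (simp add: algebra_simps power2_eq_square)
    then show ?thesis
      using \<epsilon> by simp
  qed
  have "((\<lambda>\<epsilon>. (G + M * \<tau>) * \<tau> + \<epsilon> * ((norm q)\<^sup>2 / 2 * \<tau>)) \<longlongrightarrow> (G + M * \<tau>) * \<tau> + 0 * ((norm q)\<^sup>2 / 2 * \<tau>)) (at_right 0)"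
    by (intro tendsto_intros)
  then have "inner q (h - g) \<le> (G + M * \<tau>) * \<tau> + 0 * ((norm q)\<^sup>2 / 2 * \<tau>)"
  proof (rule tendsto_lowerbound)
    show "\<forall>\<^sub>F \<epsilon> in at_right 0. inner q (h - g) \<le> (G + M * \<tau>) * \<tau> + \<epsilon> * ((norm q)\<^sup>2 / 2 * \<tau>)"
      by (rule eventually_mono[OF eventually_at_right_less]) (rule step')
  qed simp
  then show ?thesis
    by (simp add: G_def M_def \<tau>_def c_def mult_ac)
qed

text \<open>The one-sided bound of \<open>calibrated_inner_le\<close>, applied to the error vector
  itself, controls its norm.\<close>

lemma calibrated_increment:
  assumes g: "g \<in> SE2" and h: "h \<in> SE2" and u: "norm u = 1" and k: "k\<^sup>2 = 1"
    and cal: "inner (calib k u) (h - g) = sR_dist g h"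
  shows "norm (h - g - sR_dist g h *\<^sub>R calib_field k u g) \<le> 4 * norm (calib k u) * (sR_dist g h)\<^sup>2"
proof -
  define \<tau> where "\<tau> = sR_dist g h"
  define D where "D = h - g - \<tau> *\<^sub>R calib_field k u g"
  have "inner D D = inner D (h - g) - \<tau> * grad_inner (calib k u) D g"
    by (simp add: D_def inner_diff_right flip: inner_calib_field)
  also have "\<dots> \<le> \<tau> * (4 * norm (calib k u) * norm D * \<tau>)"
    using calibrated_inner_le[OF assms, of D] by (simp add: \<tau>_def algebra_simps)
  finally have "norm D * norm D \<le> norm D * (4 * norm (calib k u) * \<tau>\<^sup>2)"
    by (simp add: power2_norm_eq_inner[symmetric] power2_eq_square mult_ac)
  then show ?thesis
    by (cases "norm D = 0") (auto simp: D_def \<tau>_def)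
qed

lemma has_vector_derivative_quadratic:
  fixes f :: "real \<Rightarrow> 'a :: real_normed_vector"
  assumes K: "\<And>t. norm (f t - f s - (t - s) *\<^sub>R D) \<le> K * (t - s)\<^sup>2"
  shows "(f has_vector_derivative D) (at s)"
  unfolding has_vector_derivative_def has_derivative_at_alt
proof (intro conjI allI impI)
  fix e :: real assume e: "0 < e"
  define d where "d = e / (\<bar>K\<bar> + 1)"
  have "norm (f y - f s - (y - s) *\<^sub>R D) \<le> e * norm (y - s)" if y: "norm (y - s) < d" for y
  proof -
    have "norm (f y - f s - (y - s) *\<^sub>R D) \<le> K * (y - s)\<^sup>2"
      by (rule K)
    also have "\<dots> \<le> (\<bar>K\<bar> + 1) * (y - s)\<^sup>2"
      by (intro mult_right_mono) auto
    also have "\<dots> = ((\<bar>K\<bar> + 1) * \<bar>y - s\<bar>) * \<bar>y - s\<bar>"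
      by (simp add: power2_eq_square)
    also have "\<dots> \<le> e * \<bar>y - s\<bar>"
      using y by (intro mult_right_mono) (simp_all add: d_def field_simps)
    finally show ?thesis by simp
  qed
  moreover have "0 < d"
    using e by (simp add: d_def)
  ultimately show "\<exists>d>0. \<forall>y. norm (y - s) < d \<longrightarrow> norm (f y - f s - (y - s) *\<^sub>R D) \<le> e * norm (y - s)"
    by blast
qed (rule bounded_linear_scaleR_left)

text \<open>The quadratic increment estimate makes the line differentiable with velocity the
  calibrated gradient. Its base point is the earlier time; for backward increments the gradient is
  moved to the later point, which doubles the constant.\<close>

lemma calibrated_metric_line_type:
  assumes SE2: "\<And>t. \<gamma> t \<in> SE2" and dist: "\<And>s t. s \<le> t \<Longrightarrow> sR_dist (\<gamma> s) (\<gamma> t) = t - s"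
    and u: "norm u = 1" and k: "k\<^sup>2 = 1"
    and cal: "\<And>s t. s \<le> t \<Longrightarrow> inner (calib k u) (\<gamma> t - \<gamma> s) = t - s"
  shows "geodesic_type_line \<gamma> \<or> geodesic_type_heteroclinic \<gamma>"
proof (rule calib_field_integral_curve[OF SE2 u k])
  fix s
  define N where "N = norm (calib k u)"
  have incr: "norm (\<gamma> t - \<gamma> s - (t - s) *\<^sub>R calib_field k u (\<gamma> s)) \<le> 4 * N * (t - s)\<^sup>2" if "s \<le> t" for s t
    using calibrated_increment[OF SE2[of s] SE2[of t] u k] cal[OF that] dist[OF that] by (simp add: N_def)
  show "(\<gamma> has_vector_derivative calib_field k u (\<gamma> s)) (at s)"
  proof (rule has_vector_derivative_quadratic)
    fix t
    show "norm (\<gamma> t - \<gamma> s - (t - s) *\<^sub>R calib_field k u (\<gamma> s)) \<le> 8 * N * (t - s)\<^sup>2"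
    proof (cases "s \<le> t")
      case True
      have "4 * N * (t - s)\<^sup>2 \<le> 8 * N * (t - s)\<^sup>2"
        by (intro mult_right_mono) (auto simp: N_def)
      with incr[OF True] show ?thesis by simp
    next
      case False
      then have ts: "t \<le> s" by simp
      let ?V = "calib_field k u"
      have "norm (\<gamma> s - \<gamma> t) \<le> s - t"
        using norm_le_sR_dist[OF SE2[of t] SE2[of s]] dist[OF ts] by simp
      then have "norm (?V (\<gamma> s) - ?V (\<gamma> t)) \<le> 4 * N * (s - t)"
        using calib_field_lipschitz[OF SE2[of s] SE2[of t], of k u]
        by (smt (verit) N_def mult_left_mono norm_ge_zero)
      then have "norm ((s - t) *\<^sub>R (?V (\<gamma> s) - ?V (\<gamma> t))) \<le> (s - t) * (4 * N * (s - t))"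
        using ts by (simp add: mult_left_mono)
      then have "norm ((s - t) *\<^sub>R (?V (\<gamma> s) - ?V (\<gamma> t))) \<le> 4 * N * (s - t)\<^sup>2"
        by (simp only: power2_eq_square mult_ac)
      moreover have "norm (\<gamma> s - \<gamma> t - (s - t) *\<^sub>R ?V (\<gamma> t)) \<le> 4 * N * (s - t)\<^sup>2"
        by (rule incr[OF ts])
      moreover have eq: "\<gamma> t - \<gamma> s - (t - s) *\<^sub>R ?V (\<gamma> s)
          = (s - t) *\<^sub>R (?V (\<gamma> s) - ?V (\<gamma> t)) - (\<gamma> s - \<gamma> t - (s - t) *\<^sub>R ?V (\<gamma> t))"
        by (simp add: algebra_simps)
      ultimately show ?thesis
        using norm_triangle_ineq4[of "(s - t) *\<^sub>R (?V (\<gamma> s) - ?V (\<gamma> t))" "\<gamma> s - \<gamma> t - (s - t) *\<^sub>R ?V (\<gamma> t)"]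
        unfolding eq power2_commute[of t s] by linarith
    qed
  qed
qed

section \<open>Asymptotics of metric lines\<close>

lemma inner_le_norm_unit:
  fixes u :: "'a :: real_inner"
  assumes "norm u = 1"
  shows "inner u x \<le> norm x"
  using norm_cauchy_schwarz[of u x] assms by simp

text \<open>From \<open>- m\<close> to \<open>m\<close> the position moves by at least
  \<open>2 * m - 2 * pi\<close>. The parts outside \<open>[s, t]\<close> advance by at most their
  duration, so along the chord the part from \<open>s\<close> to \<open>t\<close> loses at most
  \<open>2 * pi\<close>. A limit of chord directions gives one \<open>u\<close> for all
  times.\<close>

lemma asymptotic_direction:
  assumes SE2: "\<And>t. \<gamma> t \<in> SE2" and dist: "\<And>s t. s \<le> t \<Longrightarrow> sR_dist (\<gamma> s) (\<gamma> t) = t - s"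
  obtains u where "norm u = 1"
    "\<And>s t. s \<le> t \<Longrightarrow> t - s - 2 * pi \<le> inner u (pos (\<gamma> t) - pos (\<gamma> s))"
proof -
  define P where "P t = pos (\<gamma> t)" for t
  have up: "norm (P t - P s) \<le> t - s" and lo: "t - s - 2 * pi \<le> norm (P t - P s)" if "s \<le> t" for s t
    using sR_dist_pos_bounds[OF SE2[of s] SE2[of t]] dist[OF that] by (simp_all add: P_def)
  \<comment> \<open>The offset 4 makes every chord nonzero: it spans time at least 8, more than
    \<open>2 * pi\<close>.\<close>
  define e where "e n = sgn (P (real (n + 4)) - P (- real (n + 4)))" for n
  have pos: "0 < norm (P (real (n + 4)) - P (- real (n + 4)))" for n
  proof -
    have "0 < real (n + 4) - - real (n + 4) - 2 * pi"
      using pi_less_4 by simp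
    then show ?thesis
      using lo[of "- real (n + 4)" "real (n + 4)"] by linarith
  qed
  then have ne: "norm (e n) = 1" for n
    by (simp add: e_def norm_sgn)
  then have "\<forall>n. e n \<in> sphere 0 1"
    by simp
  then obtain u r where u: "u \<in> sphere 0 1" and r: "strict_mono r" and lim: "(e \<circ> r) \<longlonglongrightarrow> u"
    using compact_imp_seq_compact[OF compact_sphere, of "0::complex" 1] unfolding seq_compact_def by metis
  have "t - s - 2 * pi \<le> inner u (P t - P s)" if st: "s \<le> t" for s t
  proof (rule LIMSEQ_le_const[OF tendsto_inner[OF lim tendsto_const]], intro exI allI impI)
    \<comment> \<open>From this index on \<open>[- m, m]\<close> contains \<open>s\<close> and
      \<open>t\<close>.\<close>
    fix n assume n: "nat \<lceil>max \<bar>s\<bar> \<bar>t\<bar>\<rceil> \<le> n"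
    define m where "m = real (r n + 4)"
    have "n \<le> r n"
      using r by (rule seq_suble)
    then have m: "\<bar>s\<bar> \<le> m" "\<bar>t\<bar> \<le> m"
      using n by (auto simp: m_def)
    have er: "e (r n) = sgn (P m - P (- m))"
      by (simp add: e_def m_def)
    have "inner (e (r n)) (P m - P (- m)) = norm (P m - P (- m))"
      unfolding er by (cases "P m = P (- m)") (simp_all add: sgn_div_norm power2_norm_eq_inner[symmetric] power2_eq_square)
    moreover have "2 * m - 2 * pi \<le> norm (P m - P (- m))"
      using lo[of "- m" m] m by simp
    moreover have "- m \<le> s" "t \<le> m"
      using m by linarith+
    then have "inner (e (r n)) (P s - P (- m)) \<le> s + m" "inner (e (r n)) (P m - P t) \<le> m - t"
      using inner_le_norm_unit[OF ne, of "r n" "P s - P (- m)"] up[of "- m" s]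
        inner_le_norm_unit[OF ne, of "r n" "P m - P t"] up[of t m] by linarith+
    ultimately show "t - s - 2 * pi \<le> inner ((e \<circ> r) n) (P t - P s)"
      by (simp add: inner_diff_right)
  qed
  then show ?thesis
    using that[of u] u by (simp add: P_def)
qed

text \<open>The position along \<open>u\<close> has gradient length
  \<open>\<bar>inner u (fst p)\<bar>\<close>, at most \<open>K + L n\<close> along a curve of length
  \<open>L n\<close>. So the progress is at most \<open>(K + \<tau>) * \<tau>\<close>, and fast
  progress forces \<open>K\<close> to be large.\<close>

lemma aligned_if_fast:
  assumes g: "g \<in> SE2" and h: "h \<in> SE2" and u: "norm u = 1" and d: "0 < sR_dist g h"
    and fast: "sR_dist g h - (sR_dist g h)\<^sup>2 \<le> inner u (pos h - pos g)"
  shows "1 - 2 * sR_dist g h \<le> \<bar>inner u (fst g)\<bar>"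
proof -
  define \<tau> where "\<tau> = sR_dist g h"
  define K where "K = \<bar>inner u (fst g)\<bar>"
  obtain L where L: "\<And>n. L n \<in> horizontal_lengths g h" and lim: "L \<longlonglongrightarrow> \<tau>"
    using horizontal_lengths_seq[OF g h] unfolding \<tau>_def by metis
  have "inner (calib 0 u) (h - g) \<le> (K + L n) * L n" for n
  proof (rule horizontal_lengths_inner_le[OF L])
    show "0 \<le> K + L n"
      using horizontal_lengths_nonneg[OF L] by (simp add: K_def)
    fix p assume p: "p \<in> SE2" "norm (p - g) \<le> L n"
    have "inner u (fst p) = inner u (fst g) + inner u (fst (p - g))"
      by (simp add: inner_diff_right)
    moreover have "\<bar>inner u (fst (p - g))\<bar> \<le> L n"
      using Cauchy_Schwarz_ineq2[of u "fst (p - g)"] fst_norm_le[of "p - g"] p(2) u by simp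
    ultimately have "\<bar>inner u (fst p)\<bar> \<le> K + L n"
      by (simp add: K_def)
    then have "(inner u (fst p))\<^sup>2 \<le> (K + L n)\<^sup>2"
      by (metis abs_ge_zero power2_abs power_mono)
    then show "grad_inner (calib 0 u) (calib 0 u) p \<le> (K + L n)\<^sup>2"
      by (simp add: grad_inner_def inner_calib X_theta_eq X_u_eq power2_eq_square)
  qed
  moreover have "inner (calib 0 u) (h - g) = inner u (pos h - pos g)"
    by (simp add: inner_calib inner_diff_right)
  moreover have "(\<lambda>n. (K + L n) * L n) \<longlonglongrightarrow> (K + \<tau>) * \<tau>"
    by (intro tendsto_intros lim)
  ultimately have "inner u (pos h - pos g) \<le> (K + \<tau>) * \<tau>"
    by (intro LIMSEQ_le_const) auto
  then have "\<tau> * (1 - \<tau>) \<le> \<tau> * (K + \<tau>)"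
    using fast by (simp add: \<tau>_def algebra_simps power2_eq_square)
  then show ?thesis
    using d by (simp add: \<tau>_def K_def)
qed

text \<open>If alignment failed at all times \<open>a + j * \<tau>\<close>, each step would lose at
  least \<open>\<tau>\<^sup>2\<close> against the elapsed time, and \<open>n\<close> steps more than
  the \<open>2 * pi\<close> allowed by \<open>dir\<close>. The window length
  \<open>n * \<tau>\<close> is the same for every \<open>a\<close>.\<close>

lemma ex_aligned_time:
  assumes SE2: "\<And>t. \<gamma> t \<in> SE2" and dist: "\<And>s t. s \<le> t \<Longrightarrow> sR_dist (\<gamma> s) (\<gamma> t) = t - s"
    and u: "norm u = 1"
    and dir: "\<And>s t. s \<le> t \<Longrightarrow> t - s - 2 * pi \<le> inner u (pos (\<gamma> t) - pos (\<gamma> s))"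
    and \<tau>: "0 < \<tau>"
  obtains l where "\<And>a. \<exists>T\<in>{a..a + l}. 1 - 2 * \<tau> \<le> \<bar>inner u (fst (\<gamma> T))\<bar>"
proof -
  define X where "X t = inner u (pos (\<gamma> t))" for t
  obtain n :: nat where n: "2 * pi < real n * \<tau>\<^sup>2"
    using reals_Archimedean3[of "\<tau>\<^sup>2"] \<tau> by auto
  have "\<exists>T\<in>{a..a + real n * \<tau>}. 1 - 2 * \<tau> \<le> \<bar>inner u (fst (\<gamma> T))\<bar>" for a
  proof (rule ccontr)
    assume no: "\<not> ?thesis"
    have slow: "X (a + real (Suc j) * \<tau>) - X (a + real j * \<tau>) \<le> \<tau> - \<tau>\<^sup>2" if "j \<le> n" for j
    proof -
      define T where "T = a + real j * \<tau>"
      have "T \<in> {a..a + real n * \<tau>}"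
        using that \<tau> by (auto simp: T_def intro!: mult_right_mono)
      then have "\<not> 1 - 2 * \<tau> \<le> \<bar>inner u (fst (\<gamma> T))\<bar>"
        using no by blast
      moreover have "sR_dist (\<gamma> T) (\<gamma> (T + \<tau>)) = \<tau>"
        using dist[of T "T + \<tau>"] \<tau> by simp
      ultimately have "X (T + \<tau>) - X T \<le> \<tau> - \<tau>\<^sup>2"
        using aligned_if_fast[OF SE2[of T] SE2[of "T + \<tau>"] u] \<tau> by (force simp: X_def inner_diff_right)
      then show ?thesis
        by (simp add: T_def algebra_simps)
    qed
    have "X (a + real j * \<tau>) - X a \<le> real j * (\<tau> - \<tau>\<^sup>2)" if "j \<le> n" for j
      using that
    proof (induction j)
      case (Suc j)
      then show ?case
        using slow[of j] by (simp add: algebra_simps)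
    qed simp
    then have "X (a + real n * \<tau>) - X a \<le> real n * (\<tau> - \<tau>\<^sup>2)"
      by blast
    moreover have "real n * \<tau> - 2 * pi \<le> X (a + real n * \<tau>) - X a"
      using dir[of a "a + real n * \<tau>"] \<tau> by (simp add: X_def inner_diff_right)
    ultimately show False
      using n by (simp add: algebra_simps)
  qed
  with that show ?thesis by blast
qed

text \<open>With \<open>s\<close> the sign of \<open>inner u z\<close>, the squared distance is
  \<open>2 - 2 * \<bar>inner u z\<bar>\<close>.\<close>

lemma near_direction:
  fixes z u :: "'a :: real_inner"
  assumes "norm z = 1" "norm u = 1" "1 - \<eta>\<^sup>2 / 8 \<le> \<bar>inner u z\<bar>" "0 \<le> \<eta>"
  obtains s :: real where "s\<^sup>2 = 1" "norm (z - s *\<^sub>R u) \<le> \<eta> / 2"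
proof -
  define s :: real where "s = (if 0 \<le> inner u z then 1 else - 1)"
  have s: "s\<^sup>2 = 1" "s * inner u z = \<bar>inner u z\<bar>"
    by (auto simp: s_def)
  have "inner u u = 1" "inner z z = 1"
    using assms(1,2) by (simp_all add: power2_norm_eq_inner[symmetric])
  then have "(norm (z - s *\<^sub>R u))\<^sup>2 = 1 + s\<^sup>2 - 2 * (s * inner u z)"
    unfolding power2_norm_eq_inner
    by (simp add: inner_diff_left inner_diff_right inner_commute power2_eq_square)
  also have "\<dots> \<le> (\<eta> / 2)\<^sup>2"
    using assms(3) s by (simp add: power_divide)
  finally have "norm (z - s *\<^sub>R u) \<le> \<eta> / 2"
    by (rule power2_le_imp_le) (use assms in simp)
  with s that show ?thesis by blast
qed

section \<open>From approximate to exact calibration\<close>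

text \<open>The interval is extended to distant aligned times \<open>S\<close> and \<open>T\<close>.
  Between them the functional with the chord direction \<open>e\<close> and the sign
  \<open>k\<close> at \<open>T\<close> grows by the distance up to \<open>10 * \<eta>\<close>.
  Defects of subintervals are nonnegative and add up, so \<open>[s, t]\<close> inherits the bound;
  replacing \<open>e\<close> by \<open>u\<close> adds \<open>\<eta> * (t - s + 2)\<close>.\<close>

lemma calib_defect_le:
  assumes SE2: "\<And>t. \<gamma> t \<in> SE2" and dist: "\<And>s t. s \<le> t \<Longrightarrow> sR_dist (\<gamma> s) (\<gamma> t) = t - s"
    and u: "norm u = 1"
    and dir: "\<And>s t. s \<le> t \<Longrightarrow> t - s - 2 * pi \<le> inner u (pos (\<gamma> t) - pos (\<gamma> s))"
    and \<eta>: "0 < \<eta>" "\<eta> \<le> 1/8" and st: "s \<le> t"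
  shows "\<exists>k. k\<^sup>2 = 1 \<and> t - s - inner (calib k u) (\<gamma> t - \<gamma> s) \<le> \<eta> * (t - s + 12)"
proof -
  \<comment> \<open>The choice \<open>\<eta>\<^sup>2 / 16\<close> yields the threshold of
    \<open>near_direction\<close>.\<close>
  obtain l where l: "\<And>a. \<exists>T\<in>{a..a + l}. 1 - 2 * (\<eta>\<^sup>2 / 16) \<le> \<bar>inner u (fst (\<gamma> T))\<bar>"
    using ex_aligned_time[OF SE2 dist u dir, of "\<eta>\<^sup>2 / 16"] \<eta> by auto
  obtain \<tau> where \<tau>: "0 \<le> \<tau>" "norm (Complex (tanh \<tau>) (1 / cosh \<tau>) - 1) \<le> \<eta>"
    using ex_heteroclinic_time[OF \<eta>(1)] by metis
  \<comment> \<open>The first entry ensures \<open>2 * \<tau> + 1 \<le> r\<close>, room for the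
    heteroclinic arc; the second brings the chord direction within \<open>\<eta> / 2\<close> of
    \<open>u\<close>.\<close>
  define W where "W = max (2 * \<tau> + 2 * pi + 1) (16 * pi / \<eta>\<^sup>2)"
  obtain T where T: "T \<in> {t + W..t + W + l}" "1 - \<eta>\<^sup>2 / 8 \<le> \<bar>inner u (fst (\<gamma> T))\<bar>"
    using l[of "t + W"] by auto
  obtain S where S: "S \<in> {s - l..s - l + l}" "1 - \<eta>\<^sup>2 / 8 \<le> \<bar>inner u (fst (\<gamma> S))\<bar>"
    using l[of "s - l"] by auto
  have W0: "0 \<le> W"
    using \<tau> pi_gt_zero by (auto simp: W_def le_max_iff_disj)
  have ord: "S \<le> s" "t \<le> T" "S \<le> T" "W \<le> T - S"
    using S T st W0 by auto
  have nz: "norm (fst (\<gamma> t)) = 1" for t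
    using SE2 by (simp add: SE2_iff)
  obtain k where k: "k\<^sup>2 = 1" "norm (fst (\<gamma> T) - k *\<^sub>R u) \<le> \<eta> / 2"
    using near_direction[OF nz u T(2)] \<eta> by auto
  obtain k' where k': "k'\<^sup>2 = 1" "norm (fst (\<gamma> S) - k' *\<^sub>R u) \<le> \<eta> / 2"
    using near_direction[OF nz u S(2)] \<eta> by auto
  have abs1: "\<bar>k\<bar> = 1" "\<bar>k'\<bar> = 1" "k * k = 1"
    using k(1) k'(1) by (auto simp: power2_eq_1_iff)
  define d where "d = pos (\<gamma> T) - pos (\<gamma> S)"
  define r where "r = norm d"
  define e where "e = sgn d"
  have r_le: "r \<le> T - S" and r_ge: "T - S - 2 * pi \<le> inner u d"
    using sR_dist_pos_bounds(2)[OF SE2[of S] SE2[of T]] dist[OF ord(3)] dir[OF ord(3)]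
    by (simp_all add: r_def d_def)
  have ud: "inner u d \<le> r"
    using inner_le_norm_unit[OF u] by (simp add: r_def)
  have Wr: "2 * \<tau> + 1 \<le> r"
    using r_ge ud ord(4) by (simp add: W_def)
  then have r0: "0 < r"
    using \<tau> by simp
  have ne: "norm e = 1" and de: "d = r *\<^sub>R e"
    using r0 by (auto simp: e_def r_def norm_sgn sgn_div_norm)
  \<comment> \<open>The chord has length at most \<open>T - S\<close> and advances along
    \<open>u\<close> by at least \<open>T - S - 2 * pi\<close>, so \<open>inner u e\<close> is near
    1.\<close>
  have eu: "norm (e - u) \<le> \<eta> / 2"
  proof -
    have "16 * pi / \<eta>\<^sup>2 \<le> T - S"
      using ord(4) by (simp add: W_def)
    then have big: "16 * pi \<le> (T - S) * \<eta>\<^sup>2"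
      using \<eta> by (simp add: field_simps)
    have ee: "inner e e = 1" "inner u u = 1"
      using ne u by (simp_all add: power2_norm_eq_inner[symmetric])
    have rue: "r * inner u e = inner u d"
      by (simp add: de)
    have TS0: "0 < T - S"
      using r0 r_le by simp
    have "2 * pi \<le> (T - S) * (\<eta>\<^sup>2 / 8)"
      using big by simp
    moreover have "(T - S) * (1 - \<eta>\<^sup>2 / 8) = (T - S) - (T - S) * (\<eta>\<^sup>2 / 8)"
      by (simp add: right_diff_distrib)
    ultimately have "(T - S) * (1 - \<eta>\<^sup>2 / 8) \<le> r * inner u e"
      using r_ge rue by linarith
    also have "\<dots> \<le> (T - S) * inner u e"
    proof (rule mult_right_mono[OF r_le])
      have "0 \<le> (T - S) * (1 - \<eta>\<^sup>2 / 8)"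
        using TS0 \<eta> power_le_one[of \<eta> 2] by (intro mult_nonneg_nonneg) auto
      then have "0 \<le> r * inner u e"
        using calculation by linarith
      then show "0 \<le> inner u e"
        using r0 by (simp add: zero_le_mult_iff)
    qed
    finally have "1 - \<eta>\<^sup>2 / 8 \<le> inner u e"
      using TS0 by simp
    moreover have "(norm (e - u))\<^sup>2 = 2 - 2 * inner u e"
      unfolding power2_norm_eq_inner by (simp add: inner_diff_left inner_diff_right inner_commute ee)
    ultimately have "(norm (e - u))\<^sup>2 \<le> (\<eta> / 2)\<^sup>2"
      by (simp add: power_divide)
    then show ?thesis
      by (rule power2_le_imp_le) (use \<eta> in simp)
  qed
  have near: "norm (z - j *\<^sub>R e) \<le> \<eta>" if "norm (z - j *\<^sub>R u) \<le> \<eta> / 2" "\<bar>j\<bar> = 1" for z and j :: real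
  proof -
    have "norm (z - j *\<^sub>R e) \<le> norm (z - j *\<^sub>R u) + norm (j *\<^sub>R (e - u))"
      using norm_triangle_ineq4[of "z - j *\<^sub>R u" "j *\<^sub>R (e - u)"] by (simp add: algebra_simps)
    then show ?thesis
      using that eu by simp
  qed
  have zS: "norm (fst (\<gamma> S) - k' *\<^sub>R e) \<le> \<eta>" and zT: "norm (fst (\<gamma> T) - k *\<^sub>R e) \<le> \<eta>"
    using near k k' abs1 by blast+
  have "T - S \<le> r + (1 - k' * k) + 8 * \<eta>"
    using sR_dist_near_calibrated_le[OF SE2 SE2 ne _ k'(1) k(1) \<eta>(2) zS zT \<tau>(1) _ \<tau>(2), of r]
      dist[OF ord(3)] Wr de by (simp add: d_def algebra_simps)
  \<comment> \<open>With \<open>k\<close> the sign at \<open>T\<close>, the angular term grows from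
    about \<open>k * k'\<close> to about \<open>k * k = 1\<close>, which matches the cost
    \<open>1 - k' * k\<close> of changing sign.\<close>
  moreover have "r + (1 - k' * k) - 2 * \<eta> \<le> inner (calib k e) (\<gamma> T - \<gamma> S)"
  proof -
    have eT: "inner e (fst (\<gamma> T)) = k + inner e (fst (\<gamma> T) - k *\<^sub>R e)"
      and eS: "inner e (fst (\<gamma> S)) = k' + inner e (fst (\<gamma> S) - k' *\<^sub>R e)"
      using ne by (simp_all add: inner_diff_right power2_norm_eq_inner[symmetric])
    have "\<bar>inner e (fst (\<gamma> T) - k *\<^sub>R e)\<bar> \<le> \<eta>" "\<bar>inner e (fst (\<gamma> S) - k' *\<^sub>R e)\<bar> \<le> \<eta>"
      using Cauchy_Schwarz_ineq2[of e] ne zT zS by (metis mult_1 order_trans)+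
    then have "\<bar>k * (inner e (fst (\<gamma> T) - k *\<^sub>R e) - inner e (fst (\<gamma> S) - k' *\<^sub>R e))\<bar> \<le> 2 * \<eta>"
      using abs1 by (simp add: abs_mult)
    moreover have "k * (inner e (fst (\<gamma> T)) - inner e (fst (\<gamma> S)))
        = 1 - k' * k + k * (inner e (fst (\<gamma> T) - k *\<^sub>R e) - inner e (fst (\<gamma> S) - k' *\<^sub>R e))"
      unfolding eT eS using abs1(3) by (simp add: algebra_simps)
    moreover have "inner e d = r"
      using ne by (simp add: de power2_norm_eq_inner[symmetric])
    ultimately show ?thesis
      by (simp add: inner_diff_right inner_calib d_def right_diff_distrib)
  qed
  moreover have "inner (calib k e) (\<gamma> s - \<gamma> S) \<le> s - S"
    using inner_calib_le_sR_dist[OF k(1) ne SE2[of S] SE2[of s]] dist[OF ord(1)] by simp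
  moreover have "inner (calib k e) (\<gamma> T - \<gamma> t) \<le> T - t"
    using inner_calib_le_sR_dist[OF k(1) ne SE2[of t] SE2[of T]] dist[OF ord(2)] by simp
  ultimately have e_defect: "t - s - inner (calib k e) (\<gamma> t - \<gamma> s) \<le> 10 * \<eta>"
    by (simp add: inner_diff_right)
  have "inner (calib k e) (\<gamma> t - \<gamma> s) - inner (calib k u) (\<gamma> t - \<gamma> s) \<le> \<eta> * (t - s + 2)"
  proof -
    define a b where "a = fst (\<gamma> t) - fst (\<gamma> s)" and "b = pos (\<gamma> t) - pos (\<gamma> s)"
    have "norm a \<le> 2"
      using norm_triangle_ineq4[of "fst (\<gamma> t)" "fst (\<gamma> s)"] nz by (simp add: a_def)
    moreover have "norm b \<le> t - s"
      using sR_dist_pos_bounds(2)[OF SE2[of s] SE2[of t]] dist[OF st] by (simp add: b_def)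
    moreover have "inner (calib k e) (\<gamma> t - \<gamma> s) - inner (calib k u) (\<gamma> t - \<gamma> s)
        = inner (e - u) (k *\<^sub>R a + b)"
      by (simp add: inner_diff_right inner_diff_left inner_add_right inner_calib a_def b_def algebra_simps)
    moreover have "inner (e - u) (k *\<^sub>R a + b) \<le> norm (e - u) * norm (k *\<^sub>R a + b)"
      by (rule norm_cauchy_schwarz)
    moreover have "norm (k *\<^sub>R a + b) \<le> norm a + norm b"
      using norm_triangle_ineq[of "k *\<^sub>R a" b] abs1 by simp
    ultimately have "inner (calib k e) (\<gamma> t - \<gamma> s) - inner (calib k u) (\<gamma> t - \<gamma> s)
        \<le> norm (e - u) * (t - s + 2)"
      by (smt (verit) mult_left_mono norm_ge_zero)
    also have "\<dots> \<le> \<eta> * (t - s + 2)"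
      using eu \<eta> st by (intro mult_right_mono) auto
    finally show ?thesis .
  qed
  with e_defect k(1) show ?thesis
    by (intro exI[of _ k]) (simp add: algebra_simps)
qed

text \<open>The defect of each sign is nonnegative and grows with the interval. If both signs had a
  positive defect somewhere, both would on a common interval, where \<open>calib_defect_le\<close>
  makes one of them arbitrarily small.\<close>

lemma metric_line_calibrated:
  assumes SE2: "\<And>t. \<gamma> t \<in> SE2" and dist: "\<And>s t. s \<le> t \<Longrightarrow> sR_dist (\<gamma> s) (\<gamma> t) = t - s"
  obtains u k where "norm u = 1" "k\<^sup>2 = 1" "\<And>s t. s \<le> t \<Longrightarrow> inner (calib k u) (\<gamma> t - \<gamma> s) = t - s"
proof -
  obtain u where u: "norm u = 1"
    and dir: "\<And>s t. s \<le> t \<Longrightarrow> t - s - 2 * pi \<le> inner u (pos (\<gamma> t) - pos (\<gamma> s))"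
    using asymptotic_direction[OF SE2 dist] by metis
  define f where "f k s t = t - s - inner (calib k u) (\<gamma> t - \<gamma> s)" for k s t
  have f0: "0 \<le> f k s t" if "k\<^sup>2 = 1" "s \<le> t" for k s t
    using inner_calib_le_sR_dist[OF that(1) u SE2[of s] SE2[of t]] dist[OF that(2)] by (simp add: f_def)
  have mono: "f k s t \<le> f k S T" if "k\<^sup>2 = 1" "S \<le> s" "s \<le> t" "t \<le> T" for k s t S T
  proof -
    have "f k S T = f k S s + f k s t + f k t T"
      by (simp add: f_def inner_diff_right)
    then show ?thesis
      using f0[OF that(1,2)] f0[OF that(1,4)] by simp
  qed
  have "\<exists>k. k\<^sup>2 = 1 \<and> (\<forall>s t. s \<le> t \<longrightarrow> f k s t \<le> 0)"
  proof (rule ccontr)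
    assume "\<not> ?thesis"
    then obtain s1 t1 s2 t2 where "s1 \<le> t1" "0 < f 1 s1 t1" "s2 \<le> t2" "0 < f (- 1) s2 t2"
      by (metis not_le one_power2 power2_minus)
    then have pos: "0 < f 1 (min s1 s2) (max t1 t2)" "0 < f (- 1) (min s1 s2) (max t1 t2)"
      and st: "min s1 s2 \<le> max t1 t2"
      using mono[of 1 "min s1 s2" s1 t1 "max t1 t2"] mono[of "- 1" "min s1 s2" s2 t2 "max t1 t2"] by auto
    define s t where "s = min s1 s2" and "t = max t1 t2"
    define m where "m = min (f 1 s t) (f (- 1) s t)"
    \<comment> \<open>Chosen so that \<open>\<eta> * (t - s + 12)\<close> is at most half the
      smaller defect.\<close>
    define \<eta> where "\<eta> = min (1/8) (m / (2 * (t - s + 12)))"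
    have m: "0 < m"
      using pos by (simp add: m_def s_def t_def)
    have w: "0 < t - s + 12"
      using st by (simp add: s_def t_def)
    have "0 < m / (2 * (t - s + 12))"
      using m w by (intro divide_pos_pos) auto
    then have "0 < \<eta>" "\<eta> \<le> 1/8"
      unfolding \<eta>_def by linarith+
    from calib_defect_le[OF SE2 dist u dir this, of s t] st
    obtain k where k: "k\<^sup>2 = 1" "f k s t \<le> \<eta> * (t - s + 12)"
      by (auto simp: s_def t_def f_def)
    have "\<eta> * (t - s + 12) \<le> m / (2 * (t - s + 12)) * (t - s + 12)"
      using w by (intro mult_right_mono) (auto simp: \<eta>_def)
    also have "\<dots> = m / 2"
    proof -
      have "m / (2 * x) * x = m / 2" if "0 < x" for x :: real
        using that by simp
      from this[OF w] show ?thesis .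
    qed
    finally have "f k s t \<le> m / 2"
      using k by simp
    moreover have "m \<le> f k s t"
      using k(1) by (auto simp: power2_eq_1_iff m_def)
    ultimately show False
      using m by simp
  qed
  then obtain k where k: "k\<^sup>2 = 1" and "\<And>s t. s \<le> t \<Longrightarrow> f k s t \<le> 0"
    by blast
  then have "inner (calib k u) (\<gamma> t - \<gamma> s) = t - s" if "s \<le> t" for s t
    using f0[OF k that] that by (fastforce simp: f_def)
  with that u k show ?thesis by blast
qed

theorem theorem2:
  fixes \<gamma> :: "real \<Rightarrow> se2"
  assumes "range \<gamma> \<subseteq> SE2"
  shows "metric_line \<gamma> \<longleftrightarrow> geodesic_type_line \<gamma> \<or> geodesic_type_heteroclinic \<gamma>"
proof
  assume ml: "metric_line \<gamma>"
  have SE2: "\<gamma> t \<in> SE2" for t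
    using assms by blast
  have dist: "sR_dist (\<gamma> s) (\<gamma> t) = t - s" if "s \<le> t" for s t
    using ml that unfolding metric_line_def by (metis abs_minus_commute abs_of_nonneg diff_ge_0_iff_ge)
  obtain u k where "norm u = 1" "k\<^sup>2 = 1" "\<And>s t. s \<le> t \<Longrightarrow> inner (calib k u) (\<gamma> t - \<gamma> s) = t - s"
    using metric_line_calibrated[OF SE2 dist] by metis
  then show "geodesic_type_line \<gamma> \<or> geodesic_type_heteroclinic \<gamma>"
    by (intro calibrated_metric_line_type[OF SE2 dist])
next
  assume "geodesic_type_line \<gamma> \<or> geodesic_type_heteroclinic \<gamma>"
  then show "metric_line \<gamma>"
    using type_line_is_metric_line type_heteroclinic_is_metric_line by blast
qed

end
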